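(* Fix $k\in\mathbb{N}$ and let $\mathfrak{X}_{k+1}$ be the completion of $c_{00}([\mathbb{N}]^{k+1})$ under the norm $\|x\|=\sup(\sum_{i=1}^n\|\mathcal{P}_i(x)\|_1^2)^{1/2}$, the supremum taken over all $n$ and all finite sequences $(\mathcal{P}_i)_{i=1}^n$ of pairwise disjoint Schreier plegmatic families in $[\mathbb{N}]^{k+1}$, where $\|\mathcal{P}(x)\|_1=\sum_{s\in\mathcal{P}}|x(s)|$. Let $(e_s)_{s\in[\mathbb{N}]^{k+1}}$ be the natural Hamel basis. Then: (a) $(e_s)_{s\in[\mathbb{N}]^{k+1}}$ (in any enumeration compatible with unconditionality) is an unconditional basis of $\mathfrak{X}_{k+1}$, and the $(k+1)$-sequence $(e_s)_{s\in[\mathbb{N}]^{k+1}}$ generates a $(k+1)$-spreading model isometric to the usual basis of $\ell^1$; (b) $\mathfrak{X}_{k+1}$ is reflexive; (c) no element of $\mathcal{SM}_k(\mathfrak{X}_{k+1})$ is equivalent to the usual basis of $\ell^1$; (d) for no infinite $M\subseteq\mathbb{N}$ and no $x_0\in\mathfrak{X}_{k+1}$ is $(e_s)_{s\in[M]^{k+1}}$ $(k+1)$-Cesàro summable to $x_0$.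
   Context: $[M]^k$: $k$-subsets of $M\subseteq\mathbb{N}$, identified with increasing tuples; $M(l)$ is the $l$-th element of $M$ and $M|n=\{M(1),\dots,M(n)\}$. A family $\mathcal{P}\subseteq[\mathbb{N}]^{k+1}$ is plegmatic if there are finite sets $F_1<\dots<F_{k+1}$ ($\max F_i<\min F_{i+1}$) of equal cardinality with $\mathcal{P}\subseteq F_1\times\dots\times F_{k+1}$; it is Schreier plegmatic if moreover $|F_1|\le\min F_1$. Plegma family: $(s_j)_{j=1}^l$ in $[M]^k$ with $s_1(i)<\dots<s_l(i)$ ($i\le k$), $s_l(i)<s_1(i+1)$ ($i<k$). A $k$-sequence $(x_s)_{s\in[\mathbb{N}]^k}$ in a Banach space $Y$ generates the Hamel basis $(e_n)$ of a seminormed space $(E,\|\cdot\|_* )$ as a $k$-spreading model via infinite $M$ if for a null sequence $\delta_l>0$: $|\|\sum_{j=1}^m a_jx_{s_j}\|-\|\sum_{j=1}^m a_je_j\|_*|\le\delta_l$ for all $m\le l$, plegma $(s_j)_{j=1}^m$ in $[M]^k$ with $s_1(1)\ge M(l)$, $a_j\in[-1,1]$; $\mathcal{SM}_k(Y)$ is the set of all such sequences. $(x_s)_{s\in[M]^k}$ is $k$-Cesàro summable to $x_0$ if $\binom{n}{k}^{-1}\sum_{s\in[M|n]^k}x_s\to x_0$ in norm. *)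

theory Defs
  imports "HOL-Analysis.Analysis"
begin

definition NN :: "nat set" where "NN = {1..}"

definition ksubsets :: "nat set \<Rightarrow> nat \<Rightarrow> nat set set" where
  "ksubsets A k = {s. s \<subseteq> A \<and> finite s \<and> card s = k}"

text \<open>s(i): the i-th element (1-based) of a finite set s, in increasing order.\<close>
definition el :: "nat set \<Rightarrow> nat \<Rightarrow> nat" where
  "el s i = sorted_list_of_set s ! (i - 1)"

text \<open>M(l): the l-th element (1-based) of an infinite set M.\<close>
definition elM :: "nat set \<Rightarrow> nat \<Rightarrow> nat" where
  "elM M l = enumerate M (l - 1)"

definition restr :: "nat set \<Rightarrow> nat \<Rightarrow> nat set" where
  "restr M n = elM M ` {1..n}"

definition plegmatic_witness :: "nat \<Rightarrow> nat set set \<Rightarrow> (nat \<Rightarrow> nat set) \<Rightarrow> bool" where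
  "plegmatic_witness kk P F \<longleftrightarrow>
     (\<forall>i\<in>{1..kk}. finite (F i) \<and> F i \<noteq> {} \<and> card (F i) = card (F 1)) \<and>
     (\<forall>i\<in>{1..<kk}. \<forall>a\<in>F i. \<forall>b\<in>F (Suc i). a < b) \<and>
     P \<subseteq> {s \<in> ksubsets NN kk. \<forall>i\<in>{1..kk}. el s i \<in> F i}"

definition plegmatic :: "nat \<Rightarrow> nat set set \<Rightarrow> bool" where
  "plegmatic kk P \<longleftrightarrow> (\<exists>F. plegmatic_witness kk P F)"

definition schreier_plegmatic :: "nat \<Rightarrow> nat set set \<Rightarrow> bool" where
  "schreier_plegmatic kk P \<longleftrightarrow>
     (\<exists>F. plegmatic_witness kk P F \<and> card (F 1) \<le> Min (F 1))"

definition Xnorm :: "nat \<Rightarrow> (nat set \<Rightarrow> real) \<Rightarrow> real" where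
  "Xnorm kk x = Sup {sqrt (\<Sum>i=1..n. (\<Sum>s\<in>P i. \<bar>x s\<bar>)\<^sup>2) | (n::nat) (P::nat \<Rightarrow> nat set set).
        (\<forall>i\<in>{1..n}. schreier_plegmatic kk (P i)) \<and>
        (\<forall>i\<in>{1..n}. \<forall>i'\<in>{1..n}. i \<noteq> i' \<longrightarrow> P i \<inter> P i' = {})}"

definition c00 :: "nat \<Rightarrow> (nat set \<Rightarrow> real) set" where
  "c00 kk = {x. finite {s. x s \<noteq> 0} \<and> (\<forall>s. x s \<noteq> 0 \<longrightarrow> s \<in> ksubsets NN kk)}"

definition unitvec :: "nat set \<Rightarrow> nat set \<Rightarrow> real" where
  "unitvec s = (\<lambda>t. if t = s then 1 else 0)"

text \<open>j is an isometric linear embedding of (c00, Xnorm) with dense range,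
  i.e. the target is (a model of) the completion X_kk.\<close>
definition is_completion_map :: "nat \<Rightarrow> ((nat set \<Rightarrow> real) \<Rightarrow> 'a::banach) \<Rightarrow> bool" where
  "is_completion_map kk j \<longleftrightarrow>
     (\<forall>x\<in>c00 kk. \<forall>y\<in>c00 kk. j (\<lambda>t. x t + y t) = j x + j y) \<and>
     (\<forall>x\<in>c00 kk. \<forall>c. j (\<lambda>t. c * x t) = c *\<^sub>R j x) \<and>
     (\<forall>x\<in>c00 kk. norm (j x) = Xnorm kk x) \<and>
     closure (j ` c00 kk) = UNIV"

definition unconditional_basis :: "'i set \<Rightarrow> ('i \<Rightarrow> 'a::real_normed_vector) \<Rightarrow> bool" where
  "unconditional_basis I b \<longleftrightarrow>
     (\<forall>y. \<exists>a. ((\<lambda>i. a i *\<^sub>R b i) has_sum y) I) \<and>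
     (\<forall>y a a'. ((\<lambda>i. a i *\<^sub>R b i) has_sum y) I \<and> ((\<lambda>i. a' i *\<^sub>R b i) has_sum y) I
        \<longrightarrow> (\<forall>i\<in>I. a i = a' i))"

definition reflexive :: "'a::real_normed_vector itself \<Rightarrow> bool" where
  "reflexive _ \<longleftrightarrow>
     (\<forall>\<phi> :: ('a \<Rightarrow>\<^sub>L real) \<Rightarrow>\<^sub>L real. \<exists>x::'a. \<forall>f. blinfun_apply \<phi> f = blinfun_apply f x)"

definition plegma :: "nat \<Rightarrow> nat set \<Rightarrow> nat \<Rightarrow> (nat \<Rightarrow> nat set) \<Rightarrow> bool" where
  "plegma k M m s \<longleftrightarrow>
     (\<forall>j\<in>{1..m}. s j \<in> ksubsets M k) \<and>
     (\<forall>i\<in>{1..k}. \<forall>j\<in>{1..<m}. el (s j) i < el (s (Suc j)) i) \<and>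
     (\<forall>i\<in>{1..<k}. el (s m) i < el (s 1) (Suc i))"

text \<open>The k-sequence x generates, via the infinite set M, a k-spreading model whose
  norm satisfies ||sum_{j=1}^m a_j e_j||_* = N a m.\<close>
definition generates_sm :: "nat \<Rightarrow> (nat set \<Rightarrow> 'a::real_normed_vector) \<Rightarrow> nat set
      \<Rightarrow> ((nat \<Rightarrow> real) \<Rightarrow> nat \<Rightarrow> real) \<Rightarrow> bool" where
  "generates_sm k x M N \<longleftrightarrow> M \<subseteq> NN \<and> infinite M \<and>
     (\<exists>\<delta>::nat \<Rightarrow> real. (\<forall>l. \<delta> l > 0) \<and> \<delta> \<longlonglongrightarrow> 0 \<and>
       (\<forall>l m s a. 1 \<le> m \<and> m \<le> l \<and> plegma k M m s \<and> el (s 1) 1 \<ge> elM M l \<and>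
          (\<forall>j\<in>{1..m}. \<bar>a j\<bar> \<le> 1) \<longrightarrow>
          \<bar>norm (\<Sum>j=1..m. a j *\<^sub>R x (s j)) - N a m\<bar> \<le> \<delta> l))"

definition seminormed_hamel :: "('e::real_vector \<Rightarrow> real) \<Rightarrow> (nat \<Rightarrow> 'e) \<Rightarrow> bool" where
  "seminormed_hamel nrm e \<longleftrightarrow>
     (\<forall>v. nrm v \<ge> 0) \<and> (\<forall>c v. nrm (c *\<^sub>R v) = \<bar>c\<bar> * nrm v) \<and>
     (\<forall>v w. nrm (v + w) \<le> nrm v + nrm w) \<and>
     inj e \<and> independent (range e) \<and> span (range e) = UNIV"

definition k_spreading_model :: "nat \<Rightarrow> (nat set \<Rightarrow> 'a::real_normed_vector) \<Rightarrow> nat set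
      \<Rightarrow> ('e::real_vector \<Rightarrow> real) \<Rightarrow> (nat \<Rightarrow> 'e) \<Rightarrow> bool" where
  "k_spreading_model k x M nrm e \<longleftrightarrow>
     seminormed_hamel nrm e \<and> generates_sm k x M (\<lambda>a m. nrm (\<Sum>j=1..m. a j *\<^sub>R e j))"

definition equiv_l1_basis :: "('e::real_vector \<Rightarrow> real) \<Rightarrow> (nat \<Rightarrow> 'e) \<Rightarrow> bool" where
  "equiv_l1_basis nrm e \<longleftrightarrow> (\<exists>c C. 0 < c \<and> 0 < C \<and>
     (\<forall>m a. c * (\<Sum>j=1..m. \<bar>a j\<bar>) \<le> nrm (\<Sum>j=1..m. a j *\<^sub>R e j) \<and>
            nrm (\<Sum>j=1..m. a j *\<^sub>R e j) \<le> C * (\<Sum>j=1..m. \<bar>a j\<bar>)))"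

definition cesaro_summable :: "nat \<Rightarrow> (nat set \<Rightarrow> 'a::real_normed_vector) \<Rightarrow> nat set \<Rightarrow> 'a \<Rightarrow> bool" where
  "cesaro_summable k x M x0 \<longleftrightarrow>
     (\<lambda>n. (1 / real (n choose k)) *\<^sub>R (\<Sum>s\<in>ksubsets (restr M n) k. x s)) \<longlonglongrightarrow> x0"

end

theory Submission
  imports Defs "HOL-Library.Ramsey"
begin

text \<open>
  Disjointly supported vectors satisfy a lower 2-estimate with constant 1, because admissible families
  can be merged; this makes the basis boundedly complete. The heart of the matter is that a bounded
  \<open>k\<close>-sequence \<open>(x\<^sub>s)\<close> with \<open>k < kk\<close> admits no lower \<open>\<ell>\<^sup>1\<close> estimate on plegma families. By Ramsey's
  theorem and the lower 2-estimate one may assume that, up to small norm, every entry of a coordinate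
  \<open>t\<close> in the support of \<open>x\<^sub>s\<close> is either below a constant \<open>H\<close> or in a window around an element of \<open>s\<close>.
  The coordinates with all entries below \<open>H\<close> cancel in alternating sums; those with some entries below
  \<open>H\<close> are controlled by the Schreier condition; for all others two consecutive entries of \<open>t\<close> lie in
  the same window, by the pigeonhole principle, so that no plegmatic family can meet two members of a
  plegma family. For \<open>k = 1\<close> and disjointly supported vectors this shows that the basis is shrinking,
  hence the space is reflexive.
\<close>

subsection \<open>Increasing enumeration of finite sets\<close>

lemma el_in:
  assumes "finite s" "1 \<le> i" "i \<le> card s"
  shows "el s i \<in> s"
proof -
  have "sorted_list_of_set s ! (i - 1) \<in> set (sorted_list_of_set s)"
    using assms by (intro nth_mem) auto
  then show ?thesis
    using assms by (simp add: el_def)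
qed

lemma el_less:
  assumes "finite s" "1 \<le> i" "i < i'" "i' \<le> card s"
  shows "el s i < el s i'"
  unfolding el_def
  using assms by (intro sorted_wrt_nth_less[OF strict_sorted_list_of_set]) auto

lemma el_mono:
  assumes "finite s" "1 \<le> i" "i \<le> i'" "i' \<le> card s"
  shows "el s i \<le> el s i'"
  using el_less[OF assms(1,2) _ assms(4)] assms(3) by (cases "i = i'") auto

lemma inj_on_el:
  assumes "finite s"
  shows "inj_on (el s) {1..card s}"
  by (rule linorder_inj_onI) (use el_less[OF assms] in force)+

lemma image_el:
  assumes "finite s"
  shows "el s ` {1..card s} = s"
proof (rule card_subset_eq[OF assms])
  show "el s ` {1..card s} \<subseteq> s"
    using el_in[OF assms] by auto
  show "card (el s ` {1..card s}) = card s"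
    using card_image[OF inj_on_el[OF assms]] by simp
qed

lemma el_image:
  assumes "strict_mono_on {1..k} f" "i \<in> {1..k}"
  shows "el (f ` {1..k}) i = f i"
proof -
  have "sorted_wrt (<) (map f [1..<Suc k])"
    using strict_mono_onD[OF assms(1)] by (simp add: sorted_wrt_iff_nth_less nth_append del: upt_Suc)
  moreover have "set (map f [1..<Suc k]) = f ` {1..k}"
    by (simp add: atLeastLessThanSuc_atLeastAtMost del: upt_Suc)
  moreover have "length (map f [1..<Suc k]) = card (f ` {1..k})"
    using card_image[OF strict_mono_on_imp_inj_on[OF assms(1)]] by simp
  ultimately have "sorted_list_of_set (f ` {1..k}) = map f [1..<Suc k]"
    using sorted_list_of_set_unique[of "f ` {1..k}"] by blast
  moreover have "i - 1 < length [1..<Suc k]" "1 + (i - 1) = i"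
    using assms(2) by auto
  ultimately show ?thesis
    using assms(2) by (simp add: el_def nth_upt del: upt_Suc)
qed

lemma el_Suc_card_less:
  assumes "finite s" "z \<in> s"
  shows "el s (Suc (card {y \<in> s. y < z})) = z"
proof -
  obtain i where z_eq_el: "i \<in> {1..card s}" "z = el s i"
    using image_el[OF assms(1)] assms(2) by (metis imageE)
  have "el s i' < el s i \<longleftrightarrow> i' < i" if "i' \<in> {1..card s}" for i'
    using that z_eq_el el_less[OF assms(1)] el_mono[OF assms(1)] by (metis atLeastAtMost_iff leD not_le)
  then have "{y \<in> el s ` {1..card s}. y < el s i} = el s ` {1..<i}"
    using z_eq_el(1) by auto
  then have "card {y \<in> s. y < z} = card (el s ` {1..<i})"
    unfolding image_el[OF assms(1)] z_eq_el(2) by simp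
  also have "\<dots> = i - 1"
    using z_eq_el(1) by (subst card_image) (auto intro: inj_on_subset[OF inj_on_el[OF assms(1)]])
  finally show ?thesis
    using z_eq_el by simp
qed

lemma ksubsets_mono: "A \<subseteq> B \<Longrightarrow> ksubsets A k \<subseteq> ksubsets B k"
  by (auto simp: ksubsets_def)

lemma finite_ksubsets: "finite A \<Longrightarrow> finite (ksubsets A k)"
  by (rule finite_subset[of _ "Pow A"]) (auto simp: ksubsets_def)

lemma image_strict_mono_on_in_ksubsets:
  assumes "strict_mono_on {1..k} f" "\<And>i. i \<in> {1..k} \<Longrightarrow> f i \<in> A"
  shows "f ` {1..k} \<in> ksubsets A k"
  using assms(2) card_image[OF strict_mono_on_imp_inj_on[OF assms(1)]] by (auto simp: ksubsets_def)

lemma elM_less_iff: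
  assumes "infinite M" "1 \<le> l" "1 \<le> l'"
  shows "elM M l < elM M l' \<longleftrightarrow> l < l'"
  using assms by (auto simp: elM_def)

lemma inj_on_elM:
  assumes "infinite M"
  shows "inj_on (elM M) {1..}"
proof (rule linorder_inj_onI)
  fix a b :: nat assume "a < b" "a \<in> {1..}" "b \<in> {1..}"
  then show "elM M a \<noteq> elM M b"
    using elM_less_iff[OF assms, of a b] by simp
qed auto

lemma le_elM:
  assumes "M \<subseteq> NN" "infinite M" "1 \<le> l"
  shows "l \<le> elM M l"
proof -
  have "Suc n \<le> enumerate M n" for n
  proof (induction n)
    case 0
    show ?case
      using enumerate_in_set[OF assms(2), of 0] assms(1) by (auto simp: NN_def)
  next
    case (Suc n)
    then show ?case
      using enumerate_step[OF assms(2), of n] by linarith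
  qed
  from this[of "l - 1"] show ?thesis
    using assms(3) by (simp add: elM_def)
qed

lemma restr_subset: "infinite M \<Longrightarrow> restr M n \<subseteq> M"
  by (auto simp: restr_def elM_def enumerate_in_set)

lemma finite_restr: "finite (restr M n)"
  by (simp add: restr_def)

subsection \<open>Schreier plegmatic families\<close>

lemma schreier_plegmaticI:
  assumes "1 \<le> kk" "1 \<le> n"
    and "\<And>i. i \<in> {1..kk} \<Longrightarrow> finite (F i) \<and> card (F i) = n"
    and "\<And>i a b. i \<in> {1..<kk} \<Longrightarrow> a \<in> F i \<Longrightarrow> b \<in> F (Suc i) \<Longrightarrow> a < b"
    and "\<And>a. a \<in> F 1 \<Longrightarrow> n \<le> a"
    and "P \<subseteq> ksubsets NN kk" "\<And>t i. t \<in> P \<Longrightarrow> i \<in> {1..kk} \<Longrightarrow> el t i \<in> F i"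
  shows "schreier_plegmatic kk P"
proof -
  have nonempty: "F i \<noteq> {}" if "i \<in> {1..kk}" for i
    using assms(2,3) that by fastforce
  have "plegmatic_witness kk P F"
    unfolding plegmatic_witness_def using assms nonempty by auto
  moreover have "card (F 1) \<le> Min (F 1)"
    using assms(1,3,5) nonempty[of 1] by simp
  ultimately show ?thesis
    by (auto simp: schreier_plegmatic_def)
qed

lemma schreier_plegmaticE:
  assumes "schreier_plegmatic kk P"
  obtains F where "P \<subseteq> ksubsets NN kk"
    "\<And>t i. t \<in> P \<Longrightarrow> i \<in> {1..kk} \<Longrightarrow> el t i \<in> F i"
    "\<And>i. i \<in> {1..kk} \<Longrightarrow> finite (F i)"
    "\<And>i a b. i \<in> {1..<kk} \<Longrightarrow> a \<in> F i \<Longrightarrow> b \<in> F (Suc i) \<Longrightarrow> a < b"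
    "\<And>t i. t \<in> P \<Longrightarrow> i \<in> {1..kk} \<Longrightarrow> card (F i) \<le> el t 1"
proof -
  obtain F where witness: "plegmatic_witness kk P F" "card (F 1) \<le> Min (F 1)"
    using assms by (auto simp: schreier_plegmatic_def)
  have P_subset: "P \<subseteq> ksubsets NN kk"
    using witness(1) by (auto simp: plegmatic_witness_def)
  have el_in_F: "el t i \<in> F i" if "t \<in> P" "i \<in> {1..kk}" for t i
    using witness(1) that by (auto simp: plegmatic_witness_def)
  have finite_F: "finite (F i)" and card_F: "card (F i) = card (F 1)" if "i \<in> {1..kk}" for i
    using witness(1) that unfolding plegmatic_witness_def by blast+
  have F_increasing: "a < b" if "i \<in> {1..<kk}" "a \<in> F i" "b \<in> F (Suc i)" for i a b
    using witness(1) that unfolding plegmatic_witness_def by blast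
  have card_F_le: "card (F i) \<le> el t 1" if "t \<in> P" "i \<in> {1..kk}" for t i
  proof -
    have "1 \<in> {1..kk}"
      using that(2) by simp
    then have "Min (F 1) \<le> el t 1"
      using el_in_F[OF that(1)] finite_F by (intro Min_le)
    then show ?thesis
      using card_F[OF that(2)] witness(2) by simp
  qed
  show ?thesis
    by (rule that[OF P_subset el_in_F finite_F F_increasing card_F_le])
qed

lemma schreier_plegmatic_subset:
  assumes "schreier_plegmatic kk P" "Q \<subseteq> P"
  shows "schreier_plegmatic kk Q"
proof -
  obtain F where "plegmatic_witness kk P F" "card (F 1) \<le> Min (F 1)"
    using assms(1) by (auto simp: schreier_plegmatic_def)
  moreover from this(1) assms(2) have "plegmatic_witness kk Q F"
    unfolding plegmatic_witness_def by (meson subset_trans)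
  ultimately show ?thesis
    by (auto simp: schreier_plegmatic_def)
qed

lemma schreier_plegmatic_ksubsets:
  "schreier_plegmatic kk P \<Longrightarrow> P \<subseteq> ksubsets NN kk"
  by (erule schreier_plegmaticE)

lemma schreier_plegmatic_finite:
  assumes "schreier_plegmatic kk P"
  shows "finite P"
proof -
  from assms obtain F where P_subset: "P \<subseteq> ksubsets NN kk"
    and F: "\<And>t i. t \<in> P \<Longrightarrow> i \<in> {1..kk} \<Longrightarrow> el t i \<in> F i" "\<And>i. i \<in> {1..kk} \<Longrightarrow> finite (F i)"
    by (rule schreier_plegmaticE) (rule that)
  have "P \<subseteq> ksubsets (\<Union>i\<in>{1..kk}. F i) kk"
  proof
    fix t assume "t \<in> P"
    have t_finite_card: "finite t" "card t = kk"
      using P_subset \<open>t \<in> P\<close> by (auto simp: ksubsets_def)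
    have "el t ` {1..kk} \<subseteq> (\<Union>i\<in>{1..kk}. F i)"
      using F(1)[OF \<open>t \<in> P\<close>] by blast
    then show "t \<in> ksubsets (\<Union>i\<in>{1..kk}. F i) kk"
      using image_el[OF t_finite_card(1)] t_finite_card by (simp add: ksubsets_def)
  qed
  moreover have "finite (ksubsets (\<Union>i\<in>{1..kk}. F i) kk)"
    using F(2) by (intro finite_ksubsets) simp
  ultimately show ?thesis
    by (rule finite_subset)
qed

lemma schreier_plegmatic_singleton:
  assumes "s \<in> ksubsets NN kk" "1 \<le> kk"
  shows "schreier_plegmatic kk {s}"
proof (rule schreier_plegmaticI[of _ 1 "\<lambda>i. {el s i}"])
  have s_finite_card_NN: "finite s" "card s = kk" "s \<subseteq> NN"
    using assms(1) by (auto simp: ksubsets_def)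
  show "1 \<le> a" if "a \<in> {el s 1}" for a
    using el_in[of s 1] s_finite_card_NN assms(2) that by (auto simp: NN_def)
  show "a < b" if "i \<in> {1..<kk}" "a \<in> {el s i}" "b \<in> {el s (Suc i)}" for i a b
    using el_less[OF s_finite_card_NN(1)] s_finite_card_NN(2) that by simp
qed (use assms in auto)

lemma prod_card_le_card_transversals:
  assumes "finite A" and F_subset: "\<And>i. i \<in> {1..k} \<Longrightarrow> F i \<subseteq> A"
    and F_increasing: "\<And>i i' a b. i < i' \<Longrightarrow> a \<in> F i \<Longrightarrow> b \<in> F i' \<Longrightarrow> a < b"
  shows "(\<Prod>i=1..k. card (F i)) \<le> card {t \<in> ksubsets A k. \<forall>i\<in>{1..k}. el t i \<in> F i}"
proof -
  let ?G = "\<Pi>\<^sub>E i\<in>{1..k}. F i"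
  have transversal_strict_mono: "strict_mono_on {1..k} g" if "g \<in> ?G" for g
    by (rule strict_mono_onI) (use that F_increasing in \<open>blast dest: PiE_mem\<close>)
  have el_transversal: "el (g ` {1..k}) i = g i" if "g \<in> ?G" "i \<in> {1..k}" for g i
    using el_image[OF transversal_strict_mono[OF that(1)] that(2)] .
  have "inj_on (\<lambda>g. g ` {1..k}) ?G"
  proof (rule inj_onI)
    fix g h assume g_h: "g \<in> ?G" "h \<in> ?G" "g ` {1..k} = h ` {1..k}"
    show "g = h"
      by (rule PiE_ext[OF g_h(1,2)]) (metis g_h el_transversal)
  qed
  moreover have "(\<lambda>g. g ` {1..k}) ` ?G \<subseteq> {t \<in> ksubsets A k. \<forall>i\<in>{1..k}. el t i \<in> F i}"
  proof (intro image_subsetI CollectI conjI ballI)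
    fix g assume g_in_PiE: "g \<in> ?G"
    show "g ` {1..k} \<in> ksubsets A k"
      using PiE_mem[OF g_in_PiE] F_subset
      by (intro image_strict_mono_on_in_ksubsets transversal_strict_mono g_in_PiE) blast
    show "el (g ` {1..k}) i \<in> F i" if "i \<in> {1..k}" for i
      using PiE_mem[OF g_in_PiE that] el_transversal[OF g_in_PiE that] by simp
  qed
  moreover have "finite {t \<in> ksubsets A k. \<forall>i\<in>{1..k}. el t i \<in> F i}"
    using finite_ksubsets[OF \<open>finite A\<close>] by simp
  ultimately have "card ?G \<le> card {t \<in> ksubsets A k. \<forall>i\<in>{1..k}. el t i \<in> F i}"
    by (rule card_inj_on_le)
  then show ?thesis
    by (simp add: card_PiE)
qed

lemma large_schreier_plegmatic_subfamily:
  assumes M: "M \<subseteq> NN" "infinite M" and "1 \<le> k" "1 \<le> N"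
  obtains P where "schreier_plegmatic k P" "P \<subseteq> ksubsets (restr M ((k + 1) * N)) k" "N ^ k \<le> card P"
proof -
  let ?R = "restr M ((k + 1) * N)"
  define F where "F i = elM M ` {i * N + 1..(i + 1) * N}" for i
  let ?P = "{t \<in> ksubsets ?R k. \<forall>i\<in>{1..k}. el t i \<in> F i}"
  have card_F: "card (F i) = N" for i
    unfolding F_def using inj_on_subset[OF inj_on_elM[OF M(2)]] by (subst card_image) auto
  have F_increasing: "a < b" if "i < i'" "a \<in> F i" "b \<in> F i'" for i i' a b
  proof -
    have "(i + 1) * N \<le> i' * N"
      using that(1) by (intro mult_right_mono) auto
    then show ?thesis
      using that(2,3) elM_less_iff[OF M(2)] by (auto simp: F_def)
  qed
  have F_subset: "F i \<subseteq> ?R" if "i \<in> {1..k}" for i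
  proof -
    have "(i + 1) * N \<le> (k + 1) * N"
      using that by (intro mult_right_mono) auto
    then show ?thesis
      unfolding F_def restr_def by (intro image_mono) auto
  qed
  have "schreier_plegmatic k ?P"
  proof (rule schreier_plegmaticI[OF \<open>1 \<le> k\<close> \<open>1 \<le> N\<close>])
    show "N \<le> a" if a_in_F1: "a \<in> F 1" for a
    proof -
      obtain l where "N + 1 \<le> l" "a = elM M l"
        using a_in_F1 by (auto simp: F_def)
      then show ?thesis
        using le_elM[OF M, of l] by simp
    qed
    show "?P \<subseteq> ksubsets NN k"
      using ksubsets_mono[of ?R NN k] restr_subset[OF M(2)] M(1) by blast
    show "finite (F i) \<and> card (F i) = N" for i
      unfolding card_F by (simp add: F_def)
    show "a < b" if "a \<in> F i" "b \<in> F (Suc i)" for i a b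
      using F_increasing[OF lessI that] .
  qed auto
  moreover have "(\<Prod>i=1..k. card (F i)) \<le> card ?P"
    by (rule prod_card_le_card_transversals[OF finite_restr F_subset F_increasing])
  ultimately show ?thesis
    by (intro that[of ?P]) (auto simp: card_F)
qed

subsection \<open>Finitely supported functions\<close>

lemma c00_finite: "x \<in> c00 kk \<Longrightarrow> finite {s. x s \<noteq> 0}"
  by (simp add: c00_def)

lemma c00_ksubsets: "x \<in> c00 kk \<Longrightarrow> x s \<noteq> 0 \<Longrightarrow> s \<in> ksubsets NN kk"
  by (simp add: c00_def)

lemma c00_dominated:
  assumes "x \<in> c00 kk" "\<And>s. x s = 0 \<Longrightarrow> y s = 0"
  shows "y \<in> c00 kk"
proof -
  have "{s. y s \<noteq> 0} \<subseteq> {s. x s \<noteq> 0}"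
    using assms(2) by auto
  then show ?thesis
    using assms finite_subset by (auto simp: c00_def)
qed

lemma c00_add:
  assumes "x \<in> c00 kk" "y \<in> c00 kk"
  shows "(\<lambda>s. x s + y s) \<in> c00 kk"
proof -
  have "{s. x s + y s \<noteq> 0} \<subseteq> {s. x s \<noteq> 0} \<union> {s. y s \<noteq> 0}"
    by auto
  then have "finite {s. x s + y s \<noteq> 0}"
    by (rule finite_subset) (use assms c00_finite in blast)
  moreover have "s \<in> ksubsets NN kk" if "x s + y s \<noteq> 0" for s
    using that assms[THEN c00_ksubsets, of s] by (cases "x s = 0") auto
  ultimately show ?thesis
    by (simp add: c00_def)
qed

lemma c00_zero: "(\<lambda>s. 0) \<in> c00 kk"
  by (simp add: c00_def)

lemma c00_cmult: "x \<in> c00 kk \<Longrightarrow> (\<lambda>s. c * x s) \<in> c00 kk"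
  by (erule c00_dominated) auto

lemma c00_abs: "x \<in> c00 kk \<Longrightarrow> (\<lambda>s. \<bar>x s\<bar>) \<in> c00 kk"
  by (erule c00_dominated) auto

lemma c00_diff: "x \<in> c00 kk \<Longrightarrow> y \<in> c00 kk \<Longrightarrow> (\<lambda>t. x t - y t) \<in> c00 kk"
  using c00_add[OF _ c00_cmult[of y kk "-1"]] by simp

lemma c00_sum:
  "(\<And>i. i \<in> I \<Longrightarrow> x i \<in> c00 kk) \<Longrightarrow> (\<lambda>s. \<Sum>i\<in>I. x i s) \<in> c00 kk"
  by (induction I rule: infinite_finite_induct) (auto intro: c00_zero c00_add)

lemma c00_unitvec: "s \<in> ksubsets NN kk \<Longrightarrow> unitvec s \<in> c00 kk"
  by (simp add: c00_def unitvec_def)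

definition cutoff :: "nat set set \<Rightarrow> (nat set \<Rightarrow> real) \<Rightarrow> nat set \<Rightarrow> real" where
  "cutoff A x = (\<lambda>s. if s \<in> A then x s else 0)"

lemma c00_cutoff: "x \<in> c00 kk \<Longrightarrow> cutoff A x \<in> c00 kk"
  by (erule c00_dominated) (simp add: cutoff_def)

lemma c00_cutoff_finite: "finite A \<Longrightarrow> A \<subseteq> ksubsets NN kk \<Longrightarrow> cutoff A x \<in> c00 kk"
  by (auto simp: c00_def cutoff_def)

lemma cutoff_cutoff: "cutoff A (cutoff B x) = cutoff (A \<inter> B) x"
  by (auto simp: cutoff_def)

lemma cutoff_add_Compl: "cutoff A x s + cutoff (- A) x s = x s"
  by (simp add: cutoff_def)

lemma disjoint_sequence_exists:
  assumes "\<And>A. finite A \<Longrightarrow> A \<subseteq> ksubsets NN kk \<Longrightarrow> \<exists>x\<in>c00 kk. (\<forall>t\<in>A. x t = 0) \<and> Q x"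
  shows "\<exists>x :: nat \<Rightarrow> nat set \<Rightarrow> real. (\<forall>n. x n \<in> c00 kk \<and> Q (x n)) \<and>
    (\<forall>m n t. m \<noteq> n \<longrightarrow> x m t = 0 \<or> x n t = 0)"
proof -
  define good where "good p \<longleftrightarrow> (case p of (A, x) \<Rightarrow> finite A \<and> A \<subseteq> ksubsets NN kk \<and>
    x \<in> c00 kk \<and> (\<forall>t\<in>A. x t = 0) \<and> Q x)" for p
  have extend: "\<exists>x. good (A, x)" if "finite A" "A \<subseteq> ksubsets NN kk" for A
    using assms[OF that] that by (auto simp: good_def)
  have "\<exists>f. \<forall>n. good (f n) \<and> fst (f (Suc n)) = fst (f n) \<union> {t. snd (f n) t \<noteq> 0}"
  proof (rule dependent_nat_choice)
    show "\<exists>p. good p"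
      using extend[of "{}"] by blast
    fix p assume "good p"
    then have "finite (fst p \<union> {t. snd p t \<noteq> 0})" "fst p \<union> {t. snd p t \<noteq> 0} \<subseteq> ksubsets NN kk"
      by (auto simp: good_def c00_finite c00_ksubsets)
    then show "\<exists>q. good q \<and> fst q = fst p \<union> {t. snd p t \<noteq> 0}"
      using extend by fastforce
  qed
  then obtain f where f_step: "\<And>n. good (f n)" "\<And>n. fst (f (Suc n)) = fst (f n) \<union> {t. snd (f n) t \<noteq> 0}"
    by blast
  have fst_f_mono: "fst (f m) \<subseteq> fst (f n)" if "m \<le> n" for m n
    using that by (rule lift_Suc_mono_le[of "\<lambda>n. fst (f n)", rotated]) (simp add: f_step(2))
  have snd_f_good: "snd (f n) \<in> c00 kk" "Q (snd (f n))" "\<And>t. t \<in> fst (f n) \<Longrightarrow> snd (f n) t = 0" for n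
    using f_step(1)[of n] by (auto simp: good_def split: prod.splits)
  have disjoint_if_less: "snd (f m) t = 0 \<or> snd (f n) t = 0" if "m < n" for m n t
  proof (rule disjCI)
    assume "snd (f n) t \<noteq> 0"
    then have "t \<notin> fst (f (Suc m))"
      using snd_f_good(3) fst_f_mono[of "Suc m" n] that by auto
    then show "snd (f m) t = 0"
      by (simp add: f_step(2))
  qed
  have "snd (f m) t = 0 \<or> snd (f n) t = 0" if "m \<noteq> n" for m n t
    using disjoint_if_less[of m n t] disjoint_if_less[of n m t] that by linarith
  then show ?thesis
    using snd_f_good(1,2) by (intro exI[of _ "\<lambda>n. snd (f n)"]) blast
qed

subsection \<open>The norm on finitely supported functions\<close>

definition admissible :: "nat \<Rightarrow> 'i set \<Rightarrow> ('i \<Rightarrow> nat set set) \<Rightarrow> bool" where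
  "admissible kk I P \<longleftrightarrow>
     finite I \<and> (\<forall>i\<in>I. schreier_plegmatic kk (P i)) \<and> disjoint_family_on P I"

definition family_norm :: "'i set \<Rightarrow> ('i \<Rightarrow> nat set set) \<Rightarrow> (nat set \<Rightarrow> real) \<Rightarrow> real" where
  "family_norm I P x = L2_set (\<lambda>i. \<Sum>s\<in>P i. \<bar>x s\<bar>) I"

lemma Xnorm_eq_Sup:
  "Xnorm kk x = Sup {family_norm {1..n} P x | (n::nat) P. admissible kk {1..n} P}"
  by (simp add: Xnorm_def family_norm_def L2_set_def admissible_def disjoint_family_on_def)

lemma admissible_empty: "admissible kk {} P"
  by (simp add: admissible_def disjoint_family_on_def)

lemma admissible_finite: "admissible kk I P \<Longrightarrow> i \<in> I \<Longrightarrow> finite (P i)"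
  using schreier_plegmatic_finite by (auto simp: admissible_def)

lemma admissible_Int: "admissible kk I P \<Longrightarrow> admissible kk I (\<lambda>i. P i \<inter> A)"
  using schreier_plegmatic_subset[OF _ Int_lower1]
  by (fastforce simp: admissible_def disjoint_family_on_def)

lemma admissible_Plus:
  assumes "admissible kk I P" "admissible kk I' Q" "\<And>i i'. i \<in> I \<Longrightarrow> i' \<in> I' \<Longrightarrow> P i \<inter> Q i' = {}"
  shows "admissible kk (I <+> I') (case_sum P Q)"
proof -
  have "case_sum P Q x \<inter> case_sum P Q y = {}" if "x \<in> I <+> I'" "y \<in> I <+> I'" "x \<noteq> y" for x y
    using that
  proof (elim PlusE)
    show "case_sum P Q x \<inter> case_sum P Q y = {}"
      if "i \<in> I" "x = Inl i" "i' \<in> I" "y = Inl i'" "x \<noteq> y" for i i'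
      using assms(1) that unfolding admissible_def disjoint_family_on_def by simp
    show "case_sum P Q x \<inter> case_sum P Q y = {}"
      if "i \<in> I'" "x = Inr i" "i' \<in> I'" "y = Inr i'" "x \<noteq> y" for i i'
      using assms(2) that unfolding admissible_def disjoint_family_on_def by simp
  qed (use assms(3) in \<open>auto simp: Int_commute\<close>)
  then show ?thesis
    using assms(1,2) by (auto simp: admissible_def disjoint_family_on_def)
qed

lemma family_norm_le_sum:
  assumes "x \<in> c00 kk" and P_admissible: "admissible kk I P"
  shows "family_norm I P x \<le> (\<Sum>s | x s \<noteq> 0. \<bar>x s\<bar>)"
proof -
  have "family_norm I P x \<le> (\<Sum>i\<in>I. \<Sum>s\<in>P i. \<bar>x s\<bar>)"
    unfolding family_norm_def by (intro L2_set_le_sum sum_nonneg) auto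
  also have "\<dots> = (\<Sum>s\<in>(\<Union>i\<in>I. P i). \<bar>x s\<bar>)"
    using admissible_finite[OF P_admissible] P_admissible
    by (subst sum.UNION_disjoint) (auto simp: admissible_def disjoint_family_on_def)
  also have "\<dots> = (\<Sum>s\<in>(\<Union>i\<in>I. P i) \<inter> {s. x s \<noteq> 0}. \<bar>x s\<bar>)"
    using admissible_finite[OF P_admissible] P_admissible
    by (intro sum.mono_neutral_right) (auto simp: admissible_def)
  also have "\<dots> \<le> (\<Sum>s | x s \<noteq> 0. \<bar>x s\<bar>)"
    using c00_finite[OF assms(1)] by (intro sum_mono2) auto
  finally show ?thesis .
qed

lemma family_norm_mono:
  "(\<And>s. \<bar>x s\<bar> \<le> \<bar>y s\<bar>) \<Longrightarrow> family_norm I P x \<le> family_norm I P y"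
  unfolding family_norm_def by (intro L2_set_mono sum_mono sum_nonneg) auto

lemma family_norm_Int:
  assumes "admissible kk I P"
  shows "family_norm I (\<lambda>i. P i \<inter> A) x = family_norm I P (cutoff A x)"
  unfolding family_norm_def
proof (rule L2_set_cong[OF refl])
  fix i assume "i \<in> I"
  then show "(\<Sum>s\<in>P i \<inter> A. \<bar>x s\<bar>) = (\<Sum>s\<in>P i. \<bar>cutoff A x s\<bar>)"
    using admissible_finite[OF assms]
    by (subst sum.inter_restrict) (auto simp: cutoff_def intro: sum.cong)
qed

lemma family_norm_Plus_power2:
  assumes "finite I" "finite I'"
  shows "(family_norm (I <+> I') (case_sum P Q) x)\<^sup>2 = (family_norm I P x)\<^sup>2 + (family_norm I' Q x)\<^sup>2"
  using assms by (simp add: family_norm_def L2_set_def sum_nonneg sum.Plus)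

lemma Xnorm_le:
  assumes "\<And>(n::nat) P. admissible kk {1..n} P \<Longrightarrow> family_norm {1..n} P x \<le> B"
  shows "Xnorm kk x \<le> B"
  unfolding Xnorm_eq_Sup
proof (rule cSup_least)
  have "admissible kk {1..0::nat} (\<lambda>_. {})"
    by (simp add: admissible_empty)
  then show "{family_norm {1..n} P x | (n::nat) P. admissible kk {1..n} P} \<noteq> {}"
    by blast
qed (use assms in blast)

lemma family_norm_le_Xnorm:
  assumes x_c00: "x \<in> c00 kk" and P_admissible: "admissible kk I P"
  shows "family_norm I P x \<le> Xnorm kk x"
proof -
  have "finite I"
    using P_admissible by (simp add: admissible_def)
  then obtain h where h_bij: "bij_betw h {1..card I} I"
    by (metis finite_same_card_bij card_atLeastAtMost diff_Suc_1 finite_atLeastAtMost)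
  then have "admissible kk {1..card I} (\<lambda>i. P (h i))"
    using P_admissible unfolding admissible_def disjoint_family_on_def bij_betw_def
    by (metis finite_atLeastAtMost image_eqI inj_on_eq_iff)
  moreover have "family_norm I P x = family_norm {1..card I} (\<lambda>i. P (h i)) x"
    unfolding family_norm_def L2_set_def by (subst sum.reindex_bij_betw[OF h_bij, symmetric]) simp
  ultimately show ?thesis
    unfolding Xnorm_eq_Sup using family_norm_le_sum[OF x_c00]
    by (intro cSup_upper) (auto intro!: bdd_aboveI[of _ "\<Sum>s | x s \<noteq> 0. \<bar>x s\<bar>"])
qed

lemma Xnorm_nonneg: "x \<in> c00 kk \<Longrightarrow> 0 \<le> Xnorm kk x"
  using family_norm_le_Xnorm[OF _ admissible_empty] by (simp add: family_norm_def)

lemma Xnorm_power2_add_le: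
  assumes "x \<in> c00 kk"
    and "\<And>(n::nat) P. admissible kk {1..n} P \<Longrightarrow> (family_norm {1..n} P x)\<^sup>2 + a \<le> B"
  shows "(Xnorm kk x)\<^sup>2 + a \<le> B"
proof -
  have "a \<le> B"
    using assms(2)[of 0] by (simp add: admissible_empty family_norm_def)
  have "Xnorm kk x \<le> sqrt (B - a)"
    by (intro Xnorm_le real_le_rsqrt) (use assms(2) in \<open>simp add: algebra_simps\<close>)
  then have "(Xnorm kk x)\<^sup>2 \<le> (sqrt (B - a))\<^sup>2"
    using Xnorm_nonneg[OF assms(1)] by (rule power_mono)
  then show ?thesis
    using \<open>a \<le> B\<close> by simp
qed

lemma Xnorm_le_sum:
  assumes "x \<in> c00 kk" "finite A" "\<And>s. s \<notin> A \<Longrightarrow> x s = 0"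
  shows "Xnorm kk x \<le> (\<Sum>s\<in>A. \<bar>x s\<bar>)"
proof -
  have "Xnorm kk x \<le> (\<Sum>s | x s \<noteq> 0. \<bar>x s\<bar>)"
    by (rule Xnorm_le) (rule family_norm_le_sum[OF assms(1)])
  also have "\<dots> \<le> (\<Sum>s\<in>A. \<bar>x s\<bar>)"
    using assms by (intro sum_mono2) auto
  finally show ?thesis .
qed

lemma sum_schreier_plegmatic_le_Xnorm:
  assumes "x \<in> c00 kk" "schreier_plegmatic kk P"
  shows "(\<Sum>s\<in>P. \<bar>x s\<bar>) \<le> Xnorm kk x"
  using family_norm_le_Xnorm[of x kk "{()}" "\<lambda>_. P"] assms
  by (simp add: family_norm_def sum_nonneg admissible_def disjoint_family_on_def)

lemma abs_le_Xnorm: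
  assumes "x \<in> c00 kk" "1 \<le> kk"
  shows "\<bar>x s\<bar> \<le> Xnorm kk x"
proof (cases "x s = 0")
  case False
  then have "schreier_plegmatic kk {s}"
    using c00_ksubsets[OF assms(1)] assms(2) by (intro schreier_plegmatic_singleton)
  then show ?thesis
    using sum_schreier_plegmatic_le_Xnorm[OF assms(1)] by fastforce
qed (simp add: Xnorm_nonneg assms(1))

lemma Xnorm_mono:
  assumes "y \<in> c00 kk" "\<And>s. \<bar>x s\<bar> \<le> \<bar>y s\<bar>"
  shows "Xnorm kk x \<le> Xnorm kk y"
  using assms by (intro Xnorm_le order_trans[OF family_norm_mono family_norm_le_Xnorm]) auto

lemma Xnorm_abs_cong: "(\<And>s. \<bar>x s\<bar> = \<bar>y s\<bar>) \<Longrightarrow> Xnorm kk x = Xnorm kk y"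
  by (simp add: Xnorm_def)

lemma Xnorm_cutoff_le: "x \<in> c00 kk \<Longrightarrow> Xnorm kk (cutoff A x) \<le> Xnorm kk x"
  by (rule Xnorm_mono) (auto simp: cutoff_def)

lemma Xnorm_cutoff_cutoff_le: "x \<in> c00 kk \<Longrightarrow> Xnorm kk (cutoff A (cutoff B x)) \<le> Xnorm kk (cutoff A x)"
  by (rule Xnorm_mono[OF c00_cutoff]) (auto simp: cutoff_def)

lemma Xnorm_add:
  assumes "x \<in> c00 kk" "y \<in> c00 kk"
  shows "Xnorm kk (\<lambda>s. x s + y s) \<le> Xnorm kk x + Xnorm kk y"
proof (rule Xnorm_le)
  fix n :: nat and P
  assume P_admissible: "admissible kk {1..n} P"
  have "family_norm {1..n} P (\<lambda>s. x s + y s)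
      \<le> L2_set (\<lambda>i. (\<Sum>s\<in>P i. \<bar>x s\<bar>) + (\<Sum>s\<in>P i. \<bar>y s\<bar>)) {1..n}"
    unfolding family_norm_def sum.distrib[symmetric] by (intro L2_set_mono sum_mono sum_nonneg) auto
  also have "\<dots> \<le> family_norm {1..n} P x + family_norm {1..n} P y"
    unfolding family_norm_def by (rule L2_set_triangle_ineq)
  also have "\<dots> \<le> Xnorm kk x + Xnorm kk y"
    using P_admissible by (intro add_mono family_norm_le_Xnorm assms)
  finally show "family_norm {1..n} P (\<lambda>s. x s + y s) \<le> Xnorm kk x + Xnorm kk y" .
qed

lemma Xnorm_zero: "Xnorm kk (\<lambda>s. 0) = 0"
  using Xnorm_le_sum[of "\<lambda>s. 0" kk "{}"] Xnorm_nonneg[of "\<lambda>s. 0" kk] by (simp add: c00_zero)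

lemma Xnorm_sum:
  assumes "\<And>i. i \<in> I \<Longrightarrow> x i \<in> c00 kk"
  shows "Xnorm kk (\<lambda>s. \<Sum>i\<in>I. x i s) \<le> (\<Sum>i\<in>I. Xnorm kk (x i))"
  using assms
proof (induction I rule: infinite_finite_induct)
  case (insert i I)
  have "Xnorm kk (\<lambda>s. x i s + (\<Sum>i\<in>I. x i s)) \<le> Xnorm kk (x i) + Xnorm kk (\<lambda>s. \<Sum>i\<in>I. x i s)"
    using insert by (intro Xnorm_add c00_sum) auto
  then show ?case
    using insert by force
qed (auto simp: Xnorm_zero)

lemma Xnorm_unitvec:
  assumes "s \<in> ksubsets NN kk" "1 \<le> kk"
  shows "Xnorm kk (unitvec s) = 1"
proof (rule antisym)
  show "Xnorm kk (unitvec s) \<le> 1"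
    using Xnorm_le_sum[OF c00_unitvec[OF assms(1)], of "{s}"] by (simp add: unitvec_def)
  show "1 \<le> Xnorm kk (unitvec s)"
    using abs_le_Xnorm[OF c00_unitvec[OF assms(1)] assms(2), of s] by (simp add: unitvec_def)
qed

lemma Xnorm_cutoff_Compl_power2:
  assumes x_c00: "x \<in> c00 kk"
  shows "(Xnorm kk (cutoff A x))\<^sup>2 + (Xnorm kk (cutoff (- A) x))\<^sup>2 \<le> (Xnorm kk x)\<^sup>2"
proof -
  have merged: "(family_norm {1..n} P (cutoff A x))\<^sup>2 + (family_norm {1..n'} Q (cutoff (- A) x))\<^sup>2
      \<le> (Xnorm kk x)\<^sup>2"
    if P_admissible: "admissible kk {1..n} P" and Q_admissible: "admissible kk {1..n'} Q"
      for n n' :: nat and P Q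
  proof -
    let ?R = "case_sum (\<lambda>i. P i \<inter> A) (\<lambda>i. Q i \<inter> - A)"
    have "admissible kk ({1..n} <+> {1..n'}) ?R"
      using P_admissible Q_admissible by (intro admissible_Plus admissible_Int) auto
    then have "(family_norm ({1..n} <+> {1..n'}) ?R x)\<^sup>2 \<le> (Xnorm kk x)\<^sup>2"
      by (intro power_mono family_norm_le_Xnorm[OF x_c00]) (simp_all add: family_norm_def)
    then show ?thesis
      unfolding family_norm_Plus_power2[OF finite_atLeastAtMost finite_atLeastAtMost]
        family_norm_Int[OF P_admissible] family_norm_Int[OF Q_admissible] .
  qed
  show ?thesis
  proof (rule Xnorm_power2_add_le[OF c00_cutoff[OF x_c00]])
    fix n :: nat and P assume P_admissible: "admissible kk {1..n} P"
    show "(family_norm {1..n} P (cutoff A x))\<^sup>2 + (Xnorm kk (cutoff (- A) x))\<^sup>2 \<le> (Xnorm kk x)\<^sup>2"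
      using Xnorm_power2_add_le[OF c00_cutoff[OF x_c00]] merged[OF P_admissible] by (metis add.commute)
  qed
qed

lemma Xnorm_lower_2_estimate:
  assumes "finite I" "disjoint_family_on A I" "x \<in> c00 kk"
  shows "(\<Sum>i\<in>I. (Xnorm kk (cutoff (A i) x))\<^sup>2) \<le> (Xnorm kk x)\<^sup>2"
  using assms
proof (induction I arbitrary: x rule: finite_induct)
  case (insert i I)
  have "A i' \<inter> - A i = A i'" if "i' \<in> I" for i'
    using insert.hyps(2) insert.prems(1) that by (force simp: disjoint_family_on_def)
  then have "(\<Sum>i'\<in>I. (Xnorm kk (cutoff (A i') x))\<^sup>2)
      = (\<Sum>i'\<in>I. (Xnorm kk (cutoff (A i') (cutoff (- A i) x)))\<^sup>2)"
    by (simp add: cutoff_cutoff)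
  also have "\<dots> \<le> (Xnorm kk (cutoff (- A i) x))\<^sup>2"
    using insert.prems
    by (intro insert.IH c00_cutoff) (auto intro: disjoint_family_on_mono[OF subset_insertI])
  finally show ?case
    using insert.hyps Xnorm_cutoff_Compl_power2[OF insert.prems(2), of "A i"] by simp
qed simp

lemma sum_abs_sum_power2_le:
  fixes z :: "'j \<Rightarrow> 's \<Rightarrow> real"
  assumes finite_J: "finite J" and card_meet_le: "card {j \<in> J. \<exists>s\<in>P. z j s \<noteq> 0} \<le> h"
  shows "(\<Sum>s\<in>P. \<bar>\<Sum>j\<in>J. z j s\<bar>)\<^sup>2 \<le> h * (\<Sum>j\<in>J. (\<Sum>s\<in>P. \<bar>z j s\<bar>)\<^sup>2)"
proof -
  let ?K = "{j \<in> J. \<exists>s\<in>P. z j s \<noteq> 0}"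
  have "(\<Sum>s\<in>P. \<bar>\<Sum>j\<in>J. z j s\<bar>) \<le> (\<Sum>s\<in>P. \<Sum>j\<in>J. \<bar>z j s\<bar>)"
    by (intro sum_mono sum_abs)
  also have "\<dots> = (\<Sum>j\<in>J. \<Sum>s\<in>P. \<bar>z j s\<bar>)"
    by (rule sum.swap)
  also have "\<dots> = (\<Sum>j\<in>?K. \<Sum>s\<in>P. \<bar>z j s\<bar>)"
    using finite_J by (intro sum.mono_neutral_right) auto
  finally have "(\<Sum>s\<in>P. \<bar>\<Sum>j\<in>J. z j s\<bar>)\<^sup>2 \<le> (\<Sum>j\<in>?K. \<Sum>s\<in>P. \<bar>z j s\<bar>)\<^sup>2"
    by (intro power_mono) (auto intro: sum_nonneg)
  also have "\<dots> \<le> (\<Sum>j\<in>?K. (\<Sum>s\<in>P. \<bar>z j s\<bar>)\<^sup>2) * card ?K"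
    by (rule sum_squared_le_sum_of_squares)
  also have "\<dots> \<le> (\<Sum>j\<in>J. (\<Sum>s\<in>P. \<bar>z j s\<bar>)\<^sup>2) * h"
    using card_meet_le finite_J by (intro mult_mono sum_mono2) (auto intro: sum_nonneg)
  finally show ?thesis
    by (simp add: mult.commute)
qed

lemma Xnorm_upper_2_estimate:
  assumes finite_J: "finite J" and z_c00: "\<And>j. j \<in> J \<Longrightarrow> z j \<in> c00 kk"
    and C_bound: "\<And>j. j \<in> J \<Longrightarrow> Xnorm kk (z j) \<le> C" "0 \<le> C"
    and card_meet_le: "\<And>P. schreier_plegmatic kk P \<Longrightarrow> card {j \<in> J. \<exists>s\<in>P. z j s \<noteq> 0} \<le> h"
  shows "Xnorm kk (\<lambda>s. \<Sum>j\<in>J. z j s) \<le> sqrt (real h * real (card J)) * C"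
proof (rule Xnorm_le)
  fix n :: nat and P
  assume P_admissible: "admissible kk {1..n} P"
  have column_sum_le: "(\<Sum>i=1..n. (\<Sum>s\<in>P i. \<bar>z j s\<bar>)\<^sup>2) \<le> C\<^sup>2" if "j \<in> J" for j
  proof -
    have "(family_norm {1..n} P (z j))\<^sup>2 \<le> C\<^sup>2"
      using order_trans[OF family_norm_le_Xnorm[OF z_c00 P_admissible] C_bound(1)] that
      by (intro power_mono) (auto simp: family_norm_def)
    then show ?thesis
      by (simp add: family_norm_def L2_set_def sum_nonneg)
  qed
  have "(family_norm {1..n} P (\<lambda>s. \<Sum>j\<in>J. z j s))\<^sup>2 = (\<Sum>i=1..n. (\<Sum>s\<in>P i. \<bar>\<Sum>j\<in>J. z j s\<bar>)\<^sup>2)"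
    by (simp add: family_norm_def L2_set_def sum_nonneg)
  also have "\<dots> \<le> (\<Sum>i=1..n. h * (\<Sum>j\<in>J. (\<Sum>s\<in>P i. \<bar>z j s\<bar>)\<^sup>2))"
    using P_admissible
    by (intro sum_mono sum_abs_sum_power2_le finite_J card_meet_le) (simp add: admissible_def)
  also have "\<dots> = h * (\<Sum>j\<in>J. \<Sum>i=1..n. (\<Sum>s\<in>P i. \<bar>z j s\<bar>)\<^sup>2)"
    by (simp add: sum_distrib_left[symmetric] sum.swap[of _ J])
  also have "\<dots> \<le> h * (\<Sum>j\<in>J. C\<^sup>2)"
    by (intro mult_left_mono sum_mono column_sum_le) auto
  also have "\<dots> = (sqrt (real h * real (card J)) * C)\<^sup>2"
    by (simp add: power_mult_distrib)
  finally show "family_norm {1..n} P (\<lambda>s. \<Sum>j\<in>J. z j s) \<le> sqrt (real h * real (card J)) * C"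
    by (rule power2_le_imp_le) (simp add: C_bound(2))
qed

lemma Xnorm_sum_le_cover:
  assumes finite_I: "finite I" and w_c00: "\<And>j. j \<in> J \<Longrightarrow> w j \<in> c00 kk"
    and cover: "\<And>j t. j \<in> J \<Longrightarrow> w j t \<noteq> 0 \<Longrightarrow> \<exists>i\<in>I. t \<in> E i j"
  shows "Xnorm kk (\<lambda>t. \<Sum>j\<in>J. w j t) \<le> (\<Sum>i\<in>I. Xnorm kk (\<lambda>t. \<Sum>j\<in>J. \<bar>cutoff (E i j) (w j) t\<bar>))"
proof -
  have pointwise: "\<bar>w j t\<bar> \<le> (\<Sum>i\<in>I. \<bar>cutoff (E i j) (w j) t\<bar>)" if j_in_J: "j \<in> J" for j t
  proof (cases "w j t = 0")
    case False
    then obtain i where "i \<in> I" "t \<in> E i j"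
      using cover[OF j_in_J] by blast
    then show ?thesis
      using member_le_sum[OF \<open>i \<in> I\<close>, of "\<lambda>i. \<bar>cutoff (E i j) (w j) t\<bar>"] finite_I
      by (simp add: cutoff_def)
  qed (simp add: sum_nonneg)
  have "\<bar>\<Sum>j\<in>J. w j t\<bar> \<le> (\<Sum>i\<in>I. \<Sum>j\<in>J. \<bar>cutoff (E i j) (w j) t\<bar>)" for t
    by (subst sum.swap) (intro order_trans[OF sum_abs] sum_mono pointwise)
  then have "Xnorm kk (\<lambda>t. \<Sum>j\<in>J. w j t) \<le> Xnorm kk (\<lambda>t. \<Sum>i\<in>I. \<Sum>j\<in>J. \<bar>cutoff (E i j) (w j) t\<bar>)"
    using w_c00 by (intro Xnorm_mono c00_sum c00_abs c00_cutoff order_trans[OF _ abs_ge_self]) auto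
  also have "\<dots> \<le> (\<Sum>i\<in>I. Xnorm kk (\<lambda>t. \<Sum>j\<in>J. \<bar>cutoff (E i j) (w j) t\<bar>))"
    using w_c00 by (intro Xnorm_sum c00_sum c00_abs c00_cutoff)
  finally show ?thesis .
qed

subsection \<open>Ramsey's theorem for bounded functions\<close>

lemma Ramsey_almost_constant:
  fixes f :: "nat set \<Rightarrow> real"
  assumes infinite_Z: "infinite Z" and f_bound: "\<And>X. X \<in> ksubsets Z r \<Longrightarrow> \<bar>f X\<bar> \<le> C" and "0 < \<eta>"
  obtains Y where "Y \<subseteq> Z" "infinite Y"
    "\<And>X X'. X \<in> ksubsets Y r \<Longrightarrow> X' \<in> ksubsets Y r \<Longrightarrow> \<bar>f X - f X'\<bar> \<le> \<eta>"
proof -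
  define colour where "colour X = nat \<lfloor>(f X + C) / \<eta>\<rfloor>" for X
  have colour_bounds: "real (colour X) \<le> (f X + C) / \<eta>" "(f X + C) / \<eta> < real (colour X) + 1"
    if "X \<in> ksubsets Z r" for X
  proof -
    have "0 \<le> (f X + C) / \<eta>"
      using f_bound[OF that] \<open>0 < \<eta>\<close> by (intro divide_nonneg_pos) auto
    then show "real (colour X) \<le> (f X + C) / \<eta>" "(f X + C) / \<eta> < real (colour X) + 1"
      unfolding colour_def by linarith+
  qed
  have "colour X < nat \<lfloor>2 * C / \<eta>\<rfloor> + 1" if "X \<in> ksubsets Z r" for X
  proof -
    have "(f X + C) / \<eta> \<le> 2 * C / \<eta>"
      using f_bound[OF that] \<open>0 < \<eta>\<close> by (intro divide_right_mono) auto
    then show ?thesis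
      by (simp add: colour_def nat_mono floor_mono le_imp_less_Suc)
  qed
  then obtain Y t where Y: "Y \<subseteq> Z" "infinite Y"
    and colour_eq: "\<And>X. X \<in> ksubsets Y r \<Longrightarrow> colour X = t"
    using Ramsey[OF infinite_Z, of r colour "nat \<lfloor>2 * C / \<eta>\<rfloor> + 1"] by (auto simp: ksubsets_def)
  have "\<bar>f X - f X'\<bar> \<le> \<eta>" if X_X'_in: "X \<in> ksubsets Y r" "X' \<in> ksubsets Y r" for X X'
  proof -
    have "X \<in> ksubsets Z r" "X' \<in> ksubsets Z r"
      using X_X'_in ksubsets_mono[OF Y(1)] by auto
    then have "\<bar>(f X + C) / \<eta> - (f X' + C) / \<eta>\<bar> \<le> 1"
      using colour_bounds[of X] colour_bounds[of X'] colour_eq[OF X_X'_in(1)] colour_eq[OF X_X'_in(2)]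
      by linarith
    then have "\<bar>(f X - f X') / \<eta>\<bar> \<le> 1"
      by (simp add: diff_divide_distrib add_divide_distrib)
    then show ?thesis
      using \<open>0 < \<eta>\<close> by (simp add: abs_divide)
  qed
  with Y show ?thesis
    by (rule that)
qed

lemma Ramsey_almost_constant_finite:
  fixes f :: "'i \<Rightarrow> nat set \<Rightarrow> real"
  assumes "finite I" "infinite Z" "\<And>i X. i \<in> I \<Longrightarrow> X \<in> ksubsets Z r \<Longrightarrow> \<bar>f i X\<bar> \<le> C" "0 < \<eta>"
  shows "\<exists>Y\<subseteq>Z. infinite Y \<and> (\<forall>i\<in>I. \<forall>X\<in>ksubsets Y r. \<forall>X'\<in>ksubsets Y r. \<bar>f i X - f i X'\<bar> \<le> \<eta>)"
  using assms
proof (induction I rule: finite_induct)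
  case (insert i I)
  then obtain Y where Y: "Y \<subseteq> Z" "infinite Y"
    "\<forall>i\<in>I. \<forall>X\<in>ksubsets Y r. \<forall>X'\<in>ksubsets Y r. \<bar>f i X - f i X'\<bar> \<le> \<eta>"
    by auto
  have "\<bar>f i X\<bar> \<le> C" if "X \<in> ksubsets Y r" for X
    using insert.prems(2)[of i X] ksubsets_mono[OF Y(1)] that by auto
  then obtain Y' where Y': "Y' \<subseteq> Y" "infinite Y'"
    "\<And>X X'. X \<in> ksubsets Y' r \<Longrightarrow> X' \<in> ksubsets Y' r \<Longrightarrow> \<bar>f i X - f i X'\<bar> \<le> \<eta>"
    using Ramsey_almost_constant[OF Y(2) _ \<open>0 < \<eta>\<close>, of r "f i" C] by metis
  moreover have "\<bar>f i' X - f i' X'\<bar> \<le> \<eta>"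
    if "i' \<in> I" "X \<in> ksubsets Y' r" "X' \<in> ksubsets Y' r" for i' X X'
    using Y(3) that ksubsets_mono[OF Y'(1)] by blast
  ultimately show ?case
    using Y by (intro exI[of _ Y']) auto
qed auto

subsection \<open>Small gaps\<close>

text \<open>A \<open>k\<close>-set \<open>s\<close> with a gap between \<open>z\<close> and \<open>z'\<close> is recovered from the \<open>(k + 2)\<close>-set
  \<open>s \<union> {z, z'}\<close> and the number \<open>q\<close> of elements of \<open>s\<close> below \<open>z\<close>, so that Ramsey's theorem applies to
  functions of \<open>(s, z, z')\<close>.\<close>

definition split_gap :: "nat \<Rightarrow> nat set \<Rightarrow> nat set \<times> nat \<times> nat" where
  "split_gap q u = (u - {el u (Suc q), el u (Suc (Suc q))}, el u (Suc q), el u (Suc (Suc q)))"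

lemma split_gap_insert:
  assumes "finite s" "z < z'" "s \<inter> {z..z'} = {}"
  shows "split_gap (card {y \<in> s. y < z}) (insert z (insert z' s)) = (s, z, z')"
proof -
  let ?u = "insert z (insert z' s)" and ?q = "card {y \<in> s. y < z}"
  have below_gap: "y < z" if "y \<in> s" "y < z'" for y
    using that assms(3) by (meson atLeastAtMost_iff disjoint_iff less_imp_le not_le)
  have "{y \<in> ?u. y < z} = {y \<in> s. y < z}" "{y \<in> ?u. y < z'} = insert z {y \<in> s. y < z}"
    using assms(2) below_gap by auto
  then have "card {y \<in> ?u. y < z} = ?q" "card {y \<in> ?u. y < z'} = Suc ?q"
    using assms(1) by simp_all
  then have "el ?u (Suc ?q) = z" "el ?u (Suc (Suc ?q)) = z'"
    using el_Suc_card_less[of ?u z] el_Suc_card_less[of ?u z'] assms(1) by simp_all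
  moreover have "z \<notin> s" "z' \<notin> s"
    using assms(2,3) by auto
  ultimately show ?thesis
    by (auto simp: split_gap_def)
qed

lemma split_gap_ksubsets:
  assumes "u \<in> ksubsets M (k + 2)" "q \<le> k"
  shows "fst (split_gap q u) \<in> ksubsets M k"
proof -
  have u_finite_card_subset: "finite u" "card u = k + 2" "u \<subseteq> M"
    using assms(1) by (auto simp: ksubsets_def)
  moreover have "el u (Suc q) \<in> u" "el u (Suc (Suc q)) \<in> u" "el u (Suc q) \<noteq> el u (Suc (Suc q))"
    using u_finite_card_subset assms(2) el_less[of u "Suc q" "Suc (Suc q)"] by (auto intro!: el_in)
  ultimately show ?thesis
    by (auto simp: split_gap_def ksubsets_def card_Diff_subset)
qed

lemma insert_gap_in_ksubsets:
  assumes "s \<in> ksubsets Y k" "z \<in> Y" "z' \<in> Y" "z < z'" "s \<inter> {z..z'} = {}"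
  shows "insert z (insert z' s) \<in> ksubsets Y (k + 2)"
proof -
  have "z \<notin> s" "z' \<notin> s"
    using assms(4,5) by auto
  then show ?thesis
    using assms by (auto simp: ksubsets_def)
qed

lemma consecutive_gaps_exist:
  fixes Y :: "nat set"
  assumes infinite_Y: "infinite Y" and "q \<le> k"
  obtains S v where "S \<in> ksubsets Y k" "strict_mono v" "range v \<subseteq> Y"
    "\<And>r. r < n \<Longrightarrow> S \<inter> {v r..v (Suc r)} = {} \<and> card {y \<in> S. y < v r} = q"
proof -
  let ?y = "enumerate Y"
  have enumerate_less_iff: "?y a < ?y b \<longleftrightarrow> a < b" and enumerate_le_iff: "?y a \<le> ?y b \<longleftrightarrow> a \<le> b" for a b
    using infinite_Y by (simp_all add: not_less[symmetric])
  have inj_on_enumerate: "inj_on ?y A" for A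
    by (intro inj_onI) (metis enumerate_less_iff less_irrefl linorder_neqE_nat)
  define S where "S = ?y ` ({..<q} \<union> {q + n + 1..<n + k + 1})"
  have "card S = card ({..<q} \<union> {q + n + 1..<n + k + 1})"
    unfolding S_def by (rule card_image[OF inj_on_enumerate])
  also have "\<dots> = card {..<q} + card {q + n + 1..<n + k + 1}"
    by (rule card_Un_disjoint) auto
  finally have "S \<in> ksubsets Y k"
    using \<open>q \<le> k\<close> enumerate_in_set[OF infinite_Y] by (auto simp: ksubsets_def S_def)
  moreover have "S \<inter> {?y (q + r)..?y (q + Suc r)} = {}" if "r < n" for r
    using that by (auto simp: S_def enumerate_le_iff)
  moreover have "card {y \<in> S. y < ?y (q + r)} = q" if "r < n" for r
  proof -
    have "{y \<in> S. y < ?y (q + r)} = ?y ` {..<q}"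
      using that by (auto simp: S_def enumerate_less_iff)
    then show ?thesis
      by (simp add: card_image[OF inj_on_enumerate])
  qed
  ultimately show ?thesis
    using enumerate_in_set[OF infinite_Y]
    by (intro that[of S "\<lambda>r. ?y (q + r)"]) (auto simp: strict_mono_def enumerate_less_iff)
qed

lemma Ramsey_gaps:
  fixes g :: "'i \<Rightarrow> nat set \<Rightarrow> nat \<Rightarrow> nat \<Rightarrow> real"
  assumes infinite_M: "infinite M" and finite_I: "finite I"
    and g_bound: "\<And>i s z z'. i \<in> I \<Longrightarrow> s \<in> ksubsets M k \<Longrightarrow> \<bar>g i s z z'\<bar> \<le> C" and "0 < \<delta>"
  obtains Y where "Y \<subseteq> M" "infinite Y"
    "\<And>i s z z' n. i \<in> I \<Longrightarrow> s \<in> ksubsets Y k \<Longrightarrow> z \<in> Y \<Longrightarrow> z' \<in> Y \<Longrightarrow> z < z' \<Longrightarrow> s \<inter> {z..z'} = {} \<Longrightarrow>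
      \<delta> < g i s z z' \<Longrightarrow>
      \<exists>S\<in>ksubsets Y k. \<exists>v. strict_mono v \<and> (\<forall>r<n. \<delta> / 2 < g i S (v r) (v (Suc r)))"
proof -
  define G where "G = (\<lambda>(i, q) u. case split_gap q u of (s, z, z') \<Rightarrow> g i s z z')"
  have "\<bar>G x u\<bar> \<le> C" if x_in: "x \<in> I \<times> {0..k}" and u_in: "u \<in> ksubsets M (k + 2)" for x u
    using g_bound x_in split_gap_ksubsets[OF u_in, of "snd x"] by (auto simp: G_def split: prod.splits)
  then obtain Y where Y: "Y \<subseteq> M" "infinite Y"
    and G_almost_constant: "\<And>x u u'. x \<in> I \<times> {0..k} \<Longrightarrow> u \<in> ksubsets Y (k + 2) \<Longrightarrow> u' \<in> ksubsets Y (k + 2) \<Longrightarrow>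
        \<bar>G x u - G x u'\<bar> \<le> \<delta> / 2"
    using Ramsey_almost_constant_finite[of "I \<times> {0..k}" M "k + 2" G C "\<delta> / 2"]
      infinite_M finite_I \<open>0 < \<delta>\<close>
    by (metis finite_SigmaI finite_atLeastAtMost half_gt_zero)
  have G_insert: "G (i, card {y \<in> s. y < z}) (insert z (insert z' s)) = g i s z z'"
    if "s \<in> ksubsets Y k" "z < z'" "s \<inter> {z..z'} = {}" for i s z z'
    using split_gap_insert[of s z z'] that by (simp add: G_def ksubsets_def)
  have "\<exists>S\<in>ksubsets Y k. \<exists>v. strict_mono v \<and> (\<forall>r<n. \<delta> / 2 < g i S (v r) (v (Suc r)))"
    if i_in_I: "i \<in> I" and gap: "s \<in> ksubsets Y k" "z \<in> Y" "z' \<in> Y" "z < z'" "s \<inter> {z..z'} = {}"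
      and large: "\<delta> < g i s z z'" for i s z z' n
  proof -
    define q where "q = card {y \<in> s. y < z}"
    have "q \<le> k"
      using gap(1) card_mono[of s "{y \<in> s. y < z}"] by (auto simp: q_def ksubsets_def)
    have G_large: "\<delta> / 2 < G (i, q) u" if "u \<in> ksubsets Y (k + 2)" for u
    proof -
      have "\<bar>G (i, q) u - g i s z z'\<bar> \<le> \<delta> / 2"
        using G_almost_constant[of "(i, q)" u, OF _ that insert_gap_in_ksubsets[OF gap]] i_in_I \<open>q \<le> k\<close>
        by (simp add: q_def G_insert gap)
      then show ?thesis
        using large by linarith
    qed
    obtain S v where S_in: "S \<in> ksubsets Y k" and v_strict_mono: "strict_mono v" "range v \<subseteq> Y"
      and v_gaps: "\<And>r. r < n \<Longrightarrow> S \<inter> {v r..v (Suc r)} = {} \<and> card {y \<in> S. y < v r} = q"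
      by (rule consecutive_gaps_exist[OF Y(2) \<open>q \<le> k\<close>, of n]) (rule that)
    have "\<delta> / 2 < g i S (v r) (v (Suc r))" if "r < n" for r
    proof -
      have gap_r: "v r \<in> Y" "v (Suc r) \<in> Y" "v r < v (Suc r)" "S \<inter> {v r..v (Suc r)} = {}"
        using v_strict_mono v_gaps[OF that] by (auto simp: strict_mono_def)
      show ?thesis
        using G_large[OF insert_gap_in_ksubsets[OF S_in gap_r]] G_insert[OF S_in gap_r(3,4), of i]
          v_gaps[OF that] by simp
    qed
    then show ?thesis
      using S_in v_strict_mono(1) by blast
  qed
  with Y show ?thesis
    by (rule that)
qed

definition small_gaps :: "nat \<Rightarrow> real \<Rightarrow> nat set \<Rightarrow> nat set \<Rightarrow> (nat set \<Rightarrow> real) \<Rightarrow> bool" where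
  "small_gaps kk \<delta> Y s x \<longleftrightarrow> (\<forall>i\<in>{1..kk}. \<forall>z\<in>Y. \<forall>z'\<in>Y. z < z' \<longrightarrow> s \<inter> {z..z'} = {} \<longrightarrow>
     Xnorm kk (cutoff {t. el t i \<in> {z..<z'}} x) \<le> \<delta>)"

text \<open>Otherwise many disjoint gaps of some \<open>s\<close> would carry a fixed amount of the norm of \<open>w s\<close>, against
  the lower 2-estimate.\<close>

lemma Ramsey_small_gaps:
  assumes infinite_M: "infinite M" and w_c00: "\<And>s. s \<in> ksubsets M k \<Longrightarrow> w s \<in> c00 kk"
    and norm_le_C: "\<And>s. s \<in> ksubsets M k \<Longrightarrow> Xnorm kk (w s) \<le> C" and "0 < \<delta>"
  shows "\<exists>Y\<subseteq>M. infinite Y \<and> (\<forall>s\<in>ksubsets Y k. small_gaps kk \<delta> Y s (w s))"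
proof -
  define A where "A i z z' = {t. el t i \<in> {z..<z'}}" for i z z'
  have bound: "\<bar>Xnorm kk (cutoff (A i z z') (w s))\<bar> \<le> C" if "s \<in> ksubsets M k" for i s z z'
    using order_trans[OF Xnorm_cutoff_le[OF w_c00] norm_le_C] Xnorm_nonneg[OF c00_cutoff[OF w_c00]]
      that by simp
  obtain Y where Y: "Y \<subseteq> M" "infinite Y"
    and large_gaps: "\<And>i s z z' n. i \<in> {1..kk} \<Longrightarrow> s \<in> ksubsets Y k \<Longrightarrow> z \<in> Y \<Longrightarrow> z' \<in> Y \<Longrightarrow> z < z' \<Longrightarrow>
      s \<inter> {z..z'} = {} \<Longrightarrow> \<delta> < Xnorm kk (cutoff (A i z z') (w s)) \<Longrightarrow>
      \<exists>S\<in>ksubsets Y k. \<exists>v. strict_mono v \<and>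
        (\<forall>r<n. \<delta> / 2 < Xnorm kk (cutoff (A i (v r) (v (Suc r))) (w S)))"
    using Ramsey_gaps[of M "{1..kk}" k "\<lambda>i s z z'. Xnorm kk (cutoff (A i z z') (w s))" C \<delta>]
      infinite_M bound \<open>0 < \<delta>\<close> by (metis finite_atLeastAtMost)
  obtain n where n_large: "C\<^sup>2 < real n * (\<delta> / 2)\<^sup>2"
    using \<open>0 < \<delta>\<close> reals_Archimedean3[of "(\<delta> / 2)\<^sup>2"] by auto
  have "Xnorm kk (cutoff (A i z z') (w s)) \<le> \<delta>"
    if gap: "i \<in> {1..kk}" "s \<in> ksubsets Y k" "z \<in> Y" "z' \<in> Y" "z < z'" "s \<inter> {z..z'} = {}" for i s z z'
  proof (rule ccontr)
    assume "\<not> ?thesis"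
    then obtain S v where S_in: "S \<in> ksubsets M k" and v_mono: "strict_mono v"
      and large: "\<And>r. r < n \<Longrightarrow> \<delta> / 2 < Xnorm kk (cutoff (A i (v r) (v (Suc r))) (w S))"
      using large_gaps[OF gap, of n] ksubsets_mono[OF Y(1)] by (metis not_le subsetD)
    have "A i (v r) (v (Suc r)) \<inter> A i (v r') (v (Suc r')) = {}" if "r < r'" for r r'
      using strict_mono_less_eq[OF v_mono, of "Suc r" r'] that by (auto simp: A_def)
    then have disjoint: "disjoint_family_on (\<lambda>r. A i (v r) (v (Suc r))) {..<n}"
      unfolding disjoint_family_on_def by (metis inf_commute linorder_neqE_nat)
    have "real n * (\<delta> / 2)\<^sup>2 = (\<Sum>r<n. (\<delta> / 2)\<^sup>2)"
      by simp
    also have "\<dots> \<le> (\<Sum>r<n. (Xnorm kk (cutoff (A i (v r) (v (Suc r))) (w S)))\<^sup>2)"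
      using large \<open>0 < \<delta>\<close> by (intro sum_mono power_mono less_imp_le) auto
    also have "\<dots> \<le> (Xnorm kk (w S))\<^sup>2"
      by (rule Xnorm_lower_2_estimate[OF _ disjoint w_c00[OF S_in]]) simp
    also have "\<dots> \<le> C\<^sup>2"
      using norm_le_C[OF S_in] Xnorm_nonneg[OF w_c00[OF S_in]] by (rule power_mono)
    finally show False
      using n_large by simp
  qed
  then show ?thesis
    using Y by (intro exI[of _ Y]) (auto simp: A_def small_gaps_def)
qed

lemma Ramsey_almost_equal_on_finite:
  assumes infinite_M: "infinite M" and w_c00: "\<And>s. s \<in> ksubsets M k \<Longrightarrow> w s \<in> c00 kk"
    and norm_le_C: "\<And>s. s \<in> ksubsets M k \<Longrightarrow> Xnorm kk (w s) \<le> C" and "1 \<le> kk" "finite B" "0 < \<epsilon>"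
  shows "\<exists>Y\<subseteq>M. infinite Y \<and>
    (\<forall>s\<in>ksubsets Y k. \<forall>s'\<in>ksubsets Y k. Xnorm kk (cutoff B (\<lambda>t. w s t - w s' t)) \<le> \<epsilon>)"
proof -
  define \<eta> where "\<eta> = \<epsilon> / (real (card B) + 1)"
  have "\<bar>w s t\<bar> \<le> C" if "s \<in> ksubsets M k" for s t
    using abs_le_Xnorm[OF w_c00 \<open>1 \<le> kk\<close>, of s t] norm_le_C[of s] that by simp
  moreover have "0 < \<eta>"
    using \<open>0 < \<epsilon>\<close> by (simp add: \<eta>_def)
  ultimately obtain Y where Y: "Y \<subseteq> M" "infinite Y"
    and close: "\<And>t s s'. t \<in> B \<Longrightarrow> s \<in> ksubsets Y k \<Longrightarrow> s' \<in> ksubsets Y k \<Longrightarrow> \<bar>w s t - w s' t\<bar> \<le> \<eta>"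
    using Ramsey_almost_constant_finite[OF \<open>finite B\<close> infinite_M, of k "\<lambda>t s. w s t" C \<eta>] by metis
  have "Xnorm kk (cutoff B (\<lambda>t. w s t - w s' t)) \<le> \<epsilon>"
    if s_s'_in: "s \<in> ksubsets Y k" "s' \<in> ksubsets Y k" for s s'
  proof -
    have "w s \<in> c00 kk" "w s' \<in> c00 kk"
      using w_c00 ksubsets_mono[OF Y(1)] s_s'_in by auto
    then have "Xnorm kk (cutoff B (\<lambda>t. w s t - w s' t)) \<le> (\<Sum>t\<in>B. \<bar>cutoff B (\<lambda>t. w s t - w s' t) t\<bar>)"
      by (intro Xnorm_le_sum \<open>finite B\<close> c00_cutoff c00_diff) (auto simp: cutoff_def)
    also have "\<dots> \<le> (\<Sum>t\<in>B. \<eta>)"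
      by (intro sum_mono) (simp add: cutoff_def close s_s'_in)
    also have "\<dots> \<le> \<epsilon>"
      using \<open>0 < \<epsilon>\<close> by (simp add: \<eta>_def field_simps)
    finally show ?thesis .
  qed
  then show ?thesis
    using Y by blast
qed

subsection \<open>Plegma families\<close>

lemma plegma_mono: "plegma k Y m s \<Longrightarrow> Y \<subseteq> M \<Longrightarrow> plegma k M m s"
  using ksubsets_mono[of Y M k] by (auto simp: plegma_def)

lemma plegma_less:
  assumes "plegma k M m s" "1 \<le> i" "i \<le> k" "1 \<le> a" "a < b" "b \<le> m"
  shows "el (s a) i < el (s b) i"
  using assms(5,6)
proof (induction b)
  case (Suc b)
  have "el (s b) i < el (s (Suc b)) i" if "1 \<le> b"
    using assms(1-3) Suc.prems that by (auto simp: plegma_def)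
  then show ?case
    using Suc assms(4) by (cases "a = b") auto
qed simp

lemma inj_on_plegma_el:
  assumes "plegma k M m s" "1 \<le> i" "i \<le> k"
  shows "inj_on (\<lambda>a. el (s a) i) {1..m}"
proof (rule linorder_inj_onI)
  fix a b assume "a < b" "a \<in> {1..m}" "b \<in> {1..m}"
  then show "el (s a) i \<noteq> el (s b) i"
    using plegma_less[OF assms, of a b] by auto
qed auto

lemma plegma_schreier_plegmatic:
  assumes plegma: "plegma k M m s" and M_subset: "M \<subseteq> NN"
    and k_pos: "1 \<le> k" and m_bounds: "1 \<le> m" "m \<le> el (s 1) 1"
  shows "schreier_plegmatic k (s ` {1..m})"
proof -
  have first_le: "el (s 1) i \<le> el (s a) i" and le_last: "el (s a) i \<le> el (s m) i"
    if "i \<in> {1..k}" "a \<in> {1..m}" for i a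
    using plegma_less[OF plegma, of i 1 a] plegma_less[OF plegma, of i a m] that
    by (cases "a = 1"; cases "a = m"; force)+
  show ?thesis
  proof (rule schreier_plegmaticI[OF k_pos m_bounds(1), of "\<lambda>i. (\<lambda>a. el (s a) i) ` {1..m}"])
    show "finite ((\<lambda>a. el (s a) i) ` {1..m}) \<and> card ((\<lambda>a. el (s a) i) ` {1..m}) = m"
      if "i \<in> {1..k}" for i
      using card_image[OF inj_on_plegma_el[OF plegma]] that by auto
    show "a < b" if i_in: "i \<in> {1..<k}" and a_in: "a \<in> (\<lambda>a. el (s a) i) ` {1..m}"
      and b_in: "b \<in> (\<lambda>a. el (s a) (Suc i)) ` {1..m}" for i a b
    proof -
      have "a \<le> el (s m) i" "el (s 1) (Suc i) \<le> b"
        using le_last[of i] first_le[of "Suc i"] i_in a_in b_in by auto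
      moreover have "el (s m) i < el (s 1) (Suc i)"
        using plegma i_in by (simp add: plegma_def)
      ultimately show ?thesis
        by linarith
    qed
    show "m \<le> a" if "a \<in> (\<lambda>a. el (s a) 1) ` {1..m}" for a
      using first_le[of 1] k_pos m_bounds(2) that by force
    show "s ` {1..m} \<subseteq> ksubsets NN k"
      using plegma ksubsets_mono[OF M_subset] by (auto simp: plegma_def)
  qed auto
qed

subsection \<open>Windows\<close>

definition windows :: "nat \<Rightarrow> (nat \<Rightarrow> nat) \<Rightarrow> (nat \<Rightarrow> nat) \<Rightarrow> nat set" where
  "windows k lo hi = (\<Union>q\<in>{1..k}. {lo q..<hi q})"

definition separated_windows :: "nat set \<Rightarrow> (nat \<Rightarrow> nat \<Rightarrow> nat) \<Rightarrow> (nat \<Rightarrow> nat \<Rightarrow> nat) \<Rightarrow> bool" where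
  "separated_windows J lo hi \<longleftrightarrow>
     (\<forall>q q'. \<forall>j\<in>J. \<forall>j'\<in>J. q < q' \<or> q = q' \<and> j < j' \<longrightarrow> hi j q < lo j' q')"

lemma disjoint_windows:
  assumes "separated_windows J lo hi"
  shows "disjoint_family_on (\<lambda>j. windows k (lo j) (hi j)) J"
  unfolding disjoint_family_on_def
proof (intro ballI impI, rule ccontr)
  fix j j' assume j_j'_in: "j \<in> J" "j' \<in> J" "j \<noteq> j'"
    and "windows k (lo j) (hi j) \<inter> windows k (lo j') (hi j') \<noteq> {}"
  then obtain y q q' where y_in_windows: "lo j q \<le> y" "y < hi j q" "lo j' q' \<le> y" "y < hi j' q'"
    by (auto simp: windows_def)
  have "q < q' \<or> q = q' \<and> j < j' \<or> q' < q \<or> q' = q \<and> j' < j"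
    using j_j'_in(3) by linarith
  then have "hi j q < lo j' q' \<or> hi j' q' < lo j q"
    using assms j_j'_in(1,2) unfolding separated_windows_def by blast
  then show False
    using y_in_windows by linarith
qed

text \<open>Three consecutive elements of \<open>Y\<close>, starting at the slot of \<open>(q, j)\<close>, will be the lower end of a
  window, the \<open>q\<close>-th element of the \<open>j\<close>-th member of the plegma family, and the upper end.\<close>

definition slot :: "nat \<Rightarrow> nat \<Rightarrow> nat \<Rightarrow> nat \<Rightarrow> nat" where
  "slot L m q j = L + 3 * (q * m + j)"

lemma slot_lex:
  assumes "q < q' \<and> j \<le> m \<and> 1 \<le> j' \<or> q = q' \<and> j < j'"
  shows "slot L m q j + 3 \<le> slot L m q' j'"
  using assms
proof (elim disjE conjE)
  assume "q < q'" "j \<le> m" "1 \<le> j'"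
  then have "Suc q * m \<le> q' * m"
    by (intro mult_right_mono) auto
  then show ?thesis
    using \<open>j \<le> m\<close> \<open>1 \<le> j'\<close> by (simp add: slot_def)
qed (simp add: slot_def)

lemma slot_strict_mono: "1 \<le> m \<Longrightarrow> q < q' \<Longrightarrow> slot L m q j < slot L m q' j"
  using mult_less_mono1[of q q' m] by (simp add: slot_def)

lemma separated_plegma_exists:
  assumes infinite_Y: "infinite Y" and "1 \<le> k" "1 \<le> m"
  obtains s lo hi where "plegma k Y m s" "L \<le> el (s 1) 1" "separated_windows {1..m} lo hi"
    "\<And>j q. lo j q \<in> Y \<and> hi j q \<in> Y" "\<And>j q. q \<in> {1..k} \<Longrightarrow> el (s j) q \<in> {lo j q<..<hi j q}"
proof -
  let ?y = "enumerate Y"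
  let ?p = "slot L m"
  define s where "s j = (\<lambda>q. ?y (Suc (?p q j))) ` {1..k}" for j
  have increasing: "strict_mono_on {1..k} (\<lambda>q. ?y (Suc (?p q j)))" for j
    using infinite_Y slot_strict_mono[OF \<open>1 \<le> m\<close>] by (intro strict_mono_onI) simp
  have el_s: "el (s j) q = ?y (Suc (?p q j))" if "q \<in> {1..k}" for q j
    unfolding s_def by (rule el_image[OF increasing that])
  show ?thesis
  proof (rule that[of s "\<lambda>j q. ?y (?p q j)" "\<lambda>j q. ?y (?p q j + 2)"])
    show "plegma k Y m s"
      unfolding plegma_def
    proof (intro conjI ballI)
      show "s j \<in> ksubsets Y k" for j
        unfolding s_def
          by (intro image_strict_mono_on_in_ksubsets increasing enumerate_in_set infinite_Y)
      show "el (s j) i < el (s (Suc j)) i" if "i \<in> {1..k}" for i j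
        using infinite_Y that slot_lex[of i i j m "Suc j" L] by (simp add: el_s)
      show "el (s m) i < el (s 1) (Suc i)" if "i \<in> {1..<k}" for i
        using infinite_Y that slot_lex[of i "Suc i" m m 1 L] by (simp add: el_s)
    qed
    have "L \<le> Suc (?p 1 1)"
      by (simp add: slot_def)
    also have "\<dots> \<le> el (s 1) 1"
      using le_enumerate[OF infinite_Y] \<open>1 \<le> k\<close> by (simp add: el_s)
    finally show "L \<le> el (s 1) 1" .
    show "separated_windows {1..m} (\<lambda>j q. ?y (?p q j)) (\<lambda>j q. ?y (?p q j + 2))"
      unfolding separated_windows_def
    proof (intro allI ballI impI)
      fix q q' j j' :: nat assume "j \<in> {1..m}" "j' \<in> {1..m}" "q < q' \<or> q = q' \<and> j < j'"
      then have "?p q j + 2 < ?p q' j'"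
        using slot_lex[of q q' j m j' L] by auto
      then show "?y (?p q j + 2) < ?y (?p q' j')"
        using infinite_Y by simp
    qed
    show "?y (?p q j) \<in> Y \<and> ?y (?p q j + 2) \<in> Y" for q j
      using infinite_Y by (simp add: enumerate_in_set)
    show "el (s j) q \<in> {?y (?p q j)<..<?y (?p q j + 2)}" if "q \<in> {1..k}" for q j
      using infinite_Y that by (simp add: el_s)
  qed
qed

definition off_windows :: "nat \<Rightarrow> nat \<Rightarrow> nat set \<Rightarrow> nat set set" where
  "off_windows kk H V = {t. \<exists>i\<in>{1..kk}. H \<le> el t i \<and> el t i \<notin> V}"

lemma off_windowsE:
  assumes "t \<in> off_windows kk H V"
  obtains i where "i \<in> {1..kk}" "H \<le> el t i" "el t i \<notin> V"
  using assms by (auto simp: off_windows_def)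

lemma in_gap_between_windows:
  fixes lo hi :: "nat \<Rightarrow> nat"
  assumes "hi 0 \<le> y" "y < lo (Suc k)" "y \<notin> windows k lo hi"
  shows "\<exists>q\<le>k. y \<in> {hi q..<lo (Suc q)}"
  using assms
proof (induction k)
  case (Suc k)
  show ?case
  proof (cases "y < lo (Suc k)")
    case True
    then have "\<exists>q\<le>k. y \<in> {hi q..<lo (Suc q)}"
      using Suc.prems by (intro Suc.IH) (auto simp: windows_def atLeastAtMostSuc_conv)
    then show ?thesis
      using le_SucI by blast
  next
    case False
    then have "y \<in> {hi (Suc k)..<lo (Suc (Suc k))}"
      using Suc.prems(2,3) by (simp add: windows_def atLeastAtMostSuc_conv)
    then show ?thesis
      by blast
  qed
qed auto

lemma ksubset_avoids_gap:
  fixes lo hi :: "nat \<Rightarrow> nat"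
  assumes s_finite_card: "finite s" "card s = k"
    and el_in_window: "\<And>q. q \<in> {1..k} \<Longrightarrow> el s q \<in> {lo q<..<hi q}"
    and hi_less_lo: "\<And>q q'. q < q' \<Longrightarrow> q' \<le> Suc k \<Longrightarrow> hi q < lo q'" and "q \<le> k"
  shows "s \<inter> {hi q..lo (Suc q)} = {}"
proof -
  have "el s q' < hi q \<or> lo (Suc q) < el s q'" if q'_in: "q' \<in> {1..k}" for q'
  proof (cases "q' \<le> q")
    case True
    have "hi q' \<le> hi q"
      using hi_less_lo[of q' q] el_in_window[of q] True q'_in \<open>q \<le> k\<close> by (cases "q' = q") auto
    then show ?thesis
      using el_in_window[OF q'_in] by auto
  next
    case False
    have "lo (Suc q) \<le> lo q'"
      using hi_less_lo[of "Suc q" q'] el_in_window[of "Suc q"] False q'_in by (cases "q' = Suc q") auto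
    then show ?thesis
      using el_in_window[OF q'_in] by auto
  qed
  then have "el s ` {1..k} \<inter> {hi q..lo (Suc q)} = {}"
    by fastforce
  then show ?thesis
    using image_el[OF s_finite_card(1)] s_finite_card(2) by simp
qed

lemma Xnorm_le_cover:
  assumes "finite I" "x \<in> c00 kk" "\<And>t. x t \<noteq> 0 \<Longrightarrow> \<exists>i\<in>I. t \<in> E i"
  shows "Xnorm kk x \<le> (\<Sum>i\<in>I. Xnorm kk (cutoff (E i) x))"
  using Xnorm_sum_le_cover[of I "{()}" "\<lambda>_. x" kk "\<lambda>i _. E i"] assms
    Xnorm_abs_cong[of "\<lambda>t. \<bar>cutoff (E i) x t\<bar>" "cutoff (E i) x" kk for i]
  by simp

lemma c00_support_bounded:
  assumes "x \<in> c00 kk"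
  obtains b where "\<And>t y. x t \<noteq> 0 \<Longrightarrow> y \<in> t \<Longrightarrow> y < b"
proof -
  have "finite (\<Union>{t. x t \<noteq> 0})"
    using c00_finite[OF assms] c00_ksubsets[OF assms] by (auto simp: ksubsets_def)
  then show ?thesis
    using that by (auto simp: finite_nat_set_iff_bounded)
qed

lemma Xnorm_off_windows_le_gaps:
  fixes lo hi :: "nat \<Rightarrow> nat"
  assumes x_c00: "x \<in> c00 kk" and bounded: "\<And>t y. x t \<noteq> 0 \<Longrightarrow> y \<in> t \<Longrightarrow> y < lo (Suc k)"
    and gaps: "\<And>i q. i \<in> {1..kk} \<Longrightarrow> q \<le> k \<Longrightarrow>
      Xnorm kk (cutoff {t. el t i \<in> {hi q..<lo (Suc q)}} x) \<le> \<delta>"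
  shows "Xnorm kk (cutoff (off_windows kk (hi 0) (windows k lo hi)) x) \<le> real kk * real (Suc k) * \<delta>"
proof -
  let ?off = "off_windows kk (hi 0) (windows k lo hi)"
  define E where "E = (\<lambda>(i, q). {t. el t i \<in> {hi q..<lo (Suc q)}})"
  have "\<exists>iq\<in>{1..kk} \<times> {0..k}. t \<in> E iq" if "cutoff ?off x t \<noteq> 0" for t
  proof -
    have t_off: "x t \<noteq> 0" "t \<in> ?off"
      using that by (auto simp: cutoff_def split: if_splits)
    from t_off(2) obtain i where i_off: "i \<in> {1..kk}" "hi 0 \<le> el t i" "el t i \<notin> windows k lo hi"
      by (rule off_windowsE)
    have "el t i \<in> t"
      using c00_ksubsets[OF x_c00 t_off(1)] i_off(1) by (intro el_in) (auto simp: ksubsets_def)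
    then obtain q where "q \<le> k" "el t i \<in> {hi q..<lo (Suc q)}"
      using in_gap_between_windows[of hi "el t i" lo k] i_off bounded[OF t_off(1)] by blast
    then show ?thesis
      using i_off(1) by (intro bexI[of _ "(i, q)"]) (auto simp: E_def)
  qed
  then have "Xnorm kk (cutoff ?off x) \<le> (\<Sum>iq\<in>{1..kk} \<times> {0..k}. Xnorm kk (cutoff (E iq) (cutoff ?off x)))"
    by (intro Xnorm_le_cover c00_cutoff x_c00) auto
  also have "\<dots> \<le> (\<Sum>iq\<in>{1..kk} \<times> {0..k}. \<delta>)"
    using gaps by (intro sum_mono order_trans[OF Xnorm_cutoff_cutoff_le[OF x_c00]]) (auto simp: E_def)
  finally show ?thesis
    by (simp add: distrib_left)
qed

lemma Xnorm_off_windows_le: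
  fixes lo hi :: "nat \<Rightarrow> nat"
  assumes x_c00: "x \<in> c00 kk" and gaps: "small_gaps kk \<delta> Y s x" and s_in: "s \<in> ksubsets Y k"
    and Y: "infinite Y" "H \<in> Y"
    and windows: "\<And>q. q \<in> {1..k} \<Longrightarrow> lo q \<in> Y \<and> hi q \<in> Y \<and> H < lo q \<and> el s q \<in> {lo q<..<hi q}"
    and separated: "\<And>q q'. q < q' \<Longrightarrow> hi q < lo q'"
  shows "Xnorm kk (cutoff (off_windows kk H (windows k lo hi)) x) \<le> real kk * real (Suc k) * \<delta>"
proof -
  obtain b where support_less_b: "\<And>t y. x t \<noteq> 0 \<Longrightarrow> y \<in> t \<Longrightarrow> y < b"
    using c00_support_bounded[OF x_c00] by blast
  obtain Z where Z: "Z \<in> Y" "max b (max H (Max (hi ` {0..k}))) < Z"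
    using Y(1) infinite_nat_iff_unbounded by blast
  define hi' where "hi' = hi(0 := H)"
  define lo' where "lo' = lo(Suc k := Z)"
  have separated': "hi' q < lo' q'" if "q < q'" "q' \<le> Suc k" for q q'
  proof -
    have "hi q < Z" if "q \<le> k"
      using Z(2) Max_ge[of "hi ` {0..k}" "hi q"] that by auto
    then show ?thesis
      using separated[of q q'] windows[of q'] Z(2) that by (auto simp: hi'_def lo'_def)
  qed
  have "Xnorm kk (cutoff (off_windows kk (hi' 0) (windows k lo' hi')) x) \<le> real kk * real (Suc k) * \<delta>"
  proof (rule Xnorm_off_windows_le_gaps[OF x_c00])
    show "y < lo' (Suc k)" if "x t \<noteq> 0" "y \<in> t" for t y
      using support_less_b[OF that] Z(2) by (simp add: lo'_def)
    fix i q assume i_in: "i \<in> {1..kk}" and q_le_k: "q \<le> k"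
    have "hi' q \<in> Y" "lo' (Suc q) \<in> Y"
      using windows[of q] windows[of "Suc q"] Y(2) Z(1) q_le_k by (auto simp: hi'_def lo'_def)
    moreover have "s \<inter> {hi' q..lo' (Suc q)} = {}"
      using windows s_in
      by (intro ksubset_avoids_gap[OF _ _ _ separated' q_le_k]) (auto simp: hi'_def lo'_def ksubsets_def)
    ultimately show "Xnorm kk (cutoff {t. el t i \<in> {hi' q..<lo' (Suc q)}} x) \<le> \<delta>"
      using gaps separated'[of q "Suc q"] i_in q_le_k by (simp add: small_gaps_def)
  qed
  moreover have "windows k lo' hi' = windows k lo hi"
    unfolding windows_def by (intro SUP_cong) (auto simp: hi'_def lo'_def)
  ultimately show ?thesis
    by (simp add: hi'_def)
qed

lemma plegma_off_windows_small_exists: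
  assumes Y: "infinite Y" "H \<in> Y" and Y': "infinite Y'" "Y' \<subseteq> Y - {..H}" and "1 \<le> k" "1 \<le> m"
    and w_c00: "\<And>s. s \<in> ksubsets Y k \<Longrightarrow> w s \<in> c00 kk"
    and gaps: "\<And>s. s \<in> ksubsets Y k \<Longrightarrow> small_gaps kk \<delta> Y s (w s)"
  shows "\<exists>s lo hi. plegma k Y' m s \<and> L \<le> el (s 1) 1 \<and> separated_windows {1..m} lo hi \<and>
    (\<forall>j\<in>{1..m}. Xnorm kk (cutoff (off_windows kk H (windows k (lo j) (hi j))) (w (s j)))
      \<le> real kk * real (Suc k) * \<delta>)"
proof -
  obtain s lo hi where plegma: "plegma k Y' m s" and L_le: "L \<le> el (s 1) 1"
    and separated: "separated_windows {1..m} lo hi" and ends_in: "\<And>j q. lo j q \<in> Y' \<and> hi j q \<in> Y'"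
    and el_s_in_window: "\<And>j q. q \<in> {1..k} \<Longrightarrow> el (s j) q \<in> {lo j q<..<hi j q}"
    by (rule separated_plegma_exists[OF Y'(1) \<open>1 \<le> k\<close> \<open>1 \<le> m\<close>, of L]) (rule that)
  have "Xnorm kk (cutoff (off_windows kk H (windows k (lo j) (hi j))) (w (s j)))
      \<le> real kk * real (Suc k) * \<delta>" if j_in: "j \<in> {1..m}" for j
  proof -
    have "plegma k Y m s"
      using Y'(2) by (intro plegma_mono[OF plegma]) blast
    then have s_in: "s j \<in> ksubsets Y k"
      using j_in by (simp add: plegma_def)
    show ?thesis
    proof (rule Xnorm_off_windows_le[OF w_c00[OF s_in] gaps[OF s_in] s_in Y])
      show "lo j q \<in> Y \<and> hi j q \<in> Y \<and> H < lo j q \<and> el (s j) q \<in> {lo j q<..<hi j q}" if "q \<in> {1..k}" for q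
        using ends_in[of j q] el_s_in_window[OF that, of j] Y'(2) by auto
      show "hi j q < lo j q'" if "q < q'" for q q'
        using separated j_in that by (simp add: separated_windows_def)
    qed
  qed
  then show ?thesis
    using plegma L_le separated by blast
qed

lemma consecutive_in_same_window:
  fixes lo hi :: "nat \<Rightarrow> nat"
  assumes "k < kk" and t_finite_card: "finite t" "card t = kk"
    and windows: "\<And>i. i \<in> {1..kk} \<Longrightarrow> el t i \<in> windows k lo hi"
  shows "\<exists>i\<in>{1..<kk}. \<exists>q\<in>{1..k}. el t i \<in> {lo q..<hi q} \<and> el t (Suc i) \<in> {lo q..<hi q}"
proof -
  have "\<forall>i\<in>{1..kk}. \<exists>q. q \<in> {1..k} \<and> el t i \<in> {lo q..<hi q}"
    using windows unfolding windows_def by blast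
  then obtain g where el_in_window_g: "\<And>i. i \<in> {1..kk} \<Longrightarrow> g i \<in> {1..k} \<and> el t i \<in> {lo (g i)..<hi (g i)}"
    by metis
  have "\<not> inj_on g {1..kk}"
    using card_inj_on_le[of g "{1..kk}" "{1..k}"] el_in_window_g \<open>k < kk\<close> by fastforce
  then obtain i i' where collision: "i \<in> {1..kk}" "i' \<in> {1..kk}" "i < i'" "g i = g i'"
    unfolding inj_on_def by (metis linorder_neqE_nat)
  have "el t i \<le> el t (Suc i)" "el t (Suc i) \<le> el t i'"
    using el_mono[OF t_finite_card(1)] collision t_finite_card(2) by auto
  then have "el t (Suc i) \<in> {lo (g i)..<hi (g i)}"
    using el_in_window_g[OF collision(1)] el_in_window_g[OF collision(2)] collision(4) by auto
  then show ?thesis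
    using el_in_window_g[OF collision(1)] collision by (intro bexI[of _ i] bexI[of _ "g i"]) auto
qed

lemma not_off_windows_cases:
  fixes lo hi :: "nat \<Rightarrow> nat"
  assumes "k < kk" and t_finite_card: "finite t" "card t = kk"
    and not_off: "t \<notin> off_windows kk H (windows k lo hi)"
  obtains (low) "t \<subseteq> {..<H}"
    | (straddling) "el t 1 < H" "el t kk \<in> windows k lo hi"
    | (consecutive) i q where "i \<in> {1..<kk}" "q \<in> {1..k}"
        "el t i \<in> {lo q..<hi q}" "el t (Suc i) \<in> {lo q..<hi q}"
proof (cases "el t 1 < H")
  case True
  show ?thesis
  proof (cases "el t kk < H")
    case True
    have "el t i < H" if "i \<in> {1..kk}" for i
      using el_mono[OF t_finite_card(1), of i kk] t_finite_card(2) True that by auto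
    then have "el t ` {1..card t} \<subseteq> {..<H}"
      using t_finite_card(2) by auto
    then show ?thesis
      using image_el[OF t_finite_card(1)] low by simp
  next
    case False
    then show ?thesis
      using straddling \<open>el t 1 < H\<close> not_off \<open>k < kk\<close> by (auto simp: off_windows_def)
  qed
next
  case False
  have "el t i \<in> windows k lo hi" if "i \<in> {1..kk}" for i
    using el_mono[OF t_finite_card(1), of 1 i] not_off False that t_finite_card(2)
    by (auto simp: off_windows_def)
  then show ?thesis
    using consecutive_in_same_window[OF assms(1) t_finite_card] consecutive by blast
qed

lemma card_schreier_plegmatic_straddling_le:
  assumes P_schreier: "schreier_plegmatic kk P" and "1 \<le> kk" and U_disjoint: "disjoint_family_on U J"
  shows "card {j \<in> J. P \<inter> {t. el t 1 < H \<and> el t kk \<in> U j} \<noteq> {}} \<le> H"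
    (is "card ?K \<le> H")
proof (cases "?K = {}")
  case False
  obtain F where F: "\<And>t i. t \<in> P \<Longrightarrow> i \<in> {1..kk} \<Longrightarrow> el t i \<in> F i" "\<And>i. i \<in> {1..kk} \<Longrightarrow> finite (F i)"
    and card_F_le: "\<And>t i. t \<in> P \<Longrightarrow> i \<in> {1..kk} \<Longrightarrow> card (F i) \<le> el t 1"
    by (rule schreier_plegmaticE[OF P_schreier]) (rule that)
  have kk_in: "kk \<in> {1..kk}"
    using \<open>1 \<le> kk\<close> by simp
  have "\<forall>j\<in>?K. \<exists>t. t \<in> P \<and> el t 1 < H \<and> el t kk \<in> U j"
    by auto
  then obtain T where "\<forall>j\<in>?K. T j \<in> P \<and> el (T j) 1 < H \<and> el (T j) kk \<in> U j"
    by (rule bchoice[THEN exE])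
  then have T: "T j \<in> P" "el (T j) 1 < H" "el (T j) kk \<in> U j" if "j \<in> ?K" for j
    using that by blast+
  have "inj_on (\<lambda>j. el (T j) kk) ?K"
  proof (rule inj_onI)
    fix j j' assume j_j': "j \<in> ?K" "j' \<in> ?K" "el (T j) kk = el (T j') kk"
    then have "el (T j) kk \<in> U j \<inter> U j'"
      using T(3)[OF j_j'(1)] T(3)[OF j_j'(2)] by simp
    then show "j = j'"
      using disjoint_family_onD[OF U_disjoint, of j j'] j_j' by auto
  qed
  moreover have "(\<lambda>j. el (T j) kk) ` ?K \<subseteq> F kk"
    using T(1) F(1)[OF _ kk_in] by blast
  ultimately have "card ?K \<le> card (F kk)"
    using F(2)[OF kk_in] by (intro card_inj_on_le)
  moreover obtain j where "j \<in> ?K"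
    using False by blast
  then have "card (F kk) < H"
    using T[of j] card_F_le[of "T j", OF _ kk_in] by fastforce
  ultimately show ?thesis
    by simp
qed (simp only: card.empty)

lemma card_schreier_plegmatic_consecutive_le:
  fixes lo hi :: "nat \<Rightarrow> nat"
  assumes P_schreier: "schreier_plegmatic kk P" and i_in: "i \<in> {1..<kk}" and "finite J"
    and hi_less_lo: "\<And>j j'. j \<in> J \<Longrightarrow> j' \<in> J \<Longrightarrow> j < j' \<Longrightarrow> hi j < lo j'"
  shows "card {j \<in> J. P \<inter> {t. el t i \<in> {lo j..<hi j} \<and> el t (Suc i) \<in> {lo j..<hi j}} \<noteq> {}} \<le> 1"
    (is "card ?K \<le> 1")
proof -
  obtain F where el_in_F: "\<And>t i. t \<in> P \<Longrightarrow> i \<in> {1..kk} \<Longrightarrow> el t i \<in> F i"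
    and F_increasing: "\<And>i a b. i \<in> {1..<kk} \<Longrightarrow> a \<in> F i \<Longrightarrow> b \<in> F (Suc i) \<Longrightarrow> a < b"
    by (rule schreier_plegmaticE[OF P_schreier]) (rule that)
  have False if j_j'_in: "j \<in> ?K" "j' \<in> ?K" and "j < j'" for j j'
  proof -
    obtain t t' where t_below: "t \<in> P" "el t (Suc i) < hi j" and t'_above: "t' \<in> P" "lo j' \<le> el t' i"
      using j_j'_in by auto
    have "el t (Suc i) < el t' i"
      using t_below(2) t'_above(2) hi_less_lo[OF _ _ \<open>j < j'\<close>] j_j'_in by fastforce
    moreover have "el t' i < el t (Suc i)"
      using i_in by (intro F_increasing[OF i_in] el_in_F t_below t'_above) auto
    ultimately show False
      by simp
  qed
  then have "j = j'" if "j \<in> ?K" "j' \<in> ?K" for j j'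
    using that by (cases j j' rule: linorder_cases) blast+
  then show ?thesis
    using card_le_Suc0_iff_eq[of ?K] \<open>finite J\<close> by auto
qed

subsection \<open>Alternating sums along plegma families\<close>

lemma Xnorm_sum_abs_cutoff_le:
  assumes finite_J: "finite J" and w_c00: "\<And>j. j \<in> J \<Longrightarrow> w j \<in> c00 kk"
    and C_bound: "\<And>j. j \<in> J \<Longrightarrow> Xnorm kk (w j) \<le> C" "0 \<le> C"
    and card_meet_le: "\<And>P. schreier_plegmatic kk P \<Longrightarrow> card {j \<in> J. P \<inter> E j \<noteq> {}} \<le> h"
  shows "Xnorm kk (\<lambda>t. \<Sum>j\<in>J. \<bar>cutoff (E j) (w j) t\<bar>) \<le> sqrt (real h * real (card J)) * C"
proof (rule Xnorm_upper_2_estimate[OF finite_J])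
  fix j assume j_in_J: "j \<in> J"
  show "(\<lambda>t. \<bar>cutoff (E j) (w j) t\<bar>) \<in> c00 kk"
    by (intro c00_abs c00_cutoff w_c00 j_in_J)
  have "Xnorm kk (\<lambda>t. \<bar>cutoff (E j) (w j) t\<bar>) = Xnorm kk (cutoff (E j) (w j))"
    by (rule Xnorm_abs_cong) simp
  then show "Xnorm kk (\<lambda>t. \<bar>cutoff (E j) (w j) t\<bar>) \<le> C"
    using Xnorm_cutoff_le[OF w_c00[OF j_in_J], of "E j"] C_bound(1)[OF j_in_J] by simp
next
  fix P assume P_schreier: "schreier_plegmatic kk P"
  have "card {j \<in> J. \<exists>t\<in>P. \<bar>cutoff (E j) (w j) t\<bar> \<noteq> 0} \<le> card {j \<in> J. P \<inter> E j \<noteq> {}}"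
    using finite_J by (intro card_mono) (auto simp: cutoff_def split: if_splits)
  then show "card {j \<in> J. \<exists>t\<in>P. \<bar>cutoff (E j) (w j) t\<bar> \<noteq> 0} \<le> h"
    using card_meet_le[OF P_schreier] by linarith
qed (rule C_bound(2))

lemma Xnorm_sum_on_windows_le:
  assumes k_less_kk: "k < kk" and finite_J: "finite J" and w_c00: "\<And>j. j \<in> J \<Longrightarrow> w j \<in> c00 kk"
    and C_bound: "\<And>j. j \<in> J \<Longrightarrow> Xnorm kk (w j) \<le> C" "0 \<le> C"
    and separated: "separated_windows J lo hi"
    and support: "\<And>j t. j \<in> J \<Longrightarrow> w j t \<noteq> 0 \<Longrightarrow>
      \<not> t \<subseteq> {..<H} \<and> t \<notin> off_windows kk H (windows k (lo j) (hi j))"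
  shows "Xnorm kk (\<lambda>t. \<Sum>j\<in>J. w j t) \<le> (sqrt (real H) + real kk * real k) * C * sqrt (real (card J))"
proof -
  define S where "S j = {t. el t 1 < H \<and> el t kk \<in> windows k (lo j) (hi j)}" for j
  define T where "T = (\<lambda>(i, q) j. {t. el t i \<in> {lo j q..<hi j q} \<and> el t (Suc i) \<in> {lo j q..<hi j q}})"
  define E where "E = case_option S T"
  let ?I = "{1..<kk} \<times> {1..k}"
  have cover: "\<exists>x\<in>insert None (Some ` ?I). t \<in> E x j"
    if j_in_J: "j \<in> J" and t_in_support: "w j t \<noteq> 0" for j t
  proof -
    have "finite t" "card t = kk"
      using c00_ksubsets[OF w_c00[OF j_in_J] t_in_support] by (auto simp: ksubsets_def)
    moreover have "t \<notin> off_windows kk H (windows k (lo j) (hi j))" "\<not> t \<subseteq> {..<H}"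
      using support[OF j_in_J t_in_support] by auto
    ultimately show ?thesis
      by (cases rule: not_off_windows_cases[OF k_less_kk]) (force simp: E_def S_def T_def)+
  qed
  have straddling: "Xnorm kk (\<lambda>t. \<Sum>j\<in>J. \<bar>cutoff (S j) (w j) t\<bar>) \<le> sqrt (real H * real (card J)) * C"
  proof (rule Xnorm_sum_abs_cutoff_le[OF finite_J w_c00 C_bound])
    show "card {j \<in> J. P \<inter> S j \<noteq> {}} \<le> H" if "schreier_plegmatic kk P" for P
      unfolding S_def using k_less_kk that
      by (intro card_schreier_plegmatic_straddling_le disjoint_windows[OF separated]) auto
  qed
  have consecutive: "Xnorm kk (\<lambda>t. \<Sum>j\<in>J. \<bar>cutoff (T x j) (w j) t\<bar>) \<le> sqrt (real 1 * real (card J)) * C"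
    if "x \<in> ?I" for x
  proof (rule Xnorm_sum_abs_cutoff_le[OF finite_J w_c00 C_bound])
    obtain i q where x_eq: "x = (i, q)" "i \<in> {1..<kk}"
      using \<open>x \<in> ?I\<close> by auto
    show "card {j \<in> J. P \<inter> T x j \<noteq> {}} \<le> 1" if "schreier_plegmatic kk P" for P
      unfolding T_def x_eq(1) prod.case
      using separated by (intro card_schreier_plegmatic_consecutive_le[OF that x_eq(2) finite_J])
        (auto simp: separated_windows_def)
  qed
  have "Xnorm kk (\<lambda>t. \<Sum>j\<in>J. w j t)
      \<le> (\<Sum>x\<in>insert None (Some ` ?I). Xnorm kk (\<lambda>t. \<Sum>j\<in>J. \<bar>cutoff (E x j) (w j) t\<bar>))"
    by (intro Xnorm_sum_le_cover w_c00 cover) auto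
  also have "\<dots> = Xnorm kk (\<lambda>t. \<Sum>j\<in>J. \<bar>cutoff (S j) (w j) t\<bar>)
      + (\<Sum>x\<in>?I. Xnorm kk (\<lambda>t. \<Sum>j\<in>J. \<bar>cutoff (T x j) (w j) t\<bar>))"
    by (subst sum.insert) (auto simp: E_def sum.reindex)
  also have "\<dots> \<le> sqrt (real H * real (card J)) * C + (\<Sum>x\<in>?I. sqrt (real 1 * real (card J)) * C)"
    by (intro add_mono sum_mono straddling consecutive)
  also have "\<dots> \<le> sqrt (real H * real (card J)) * C + real kk * real k * (sqrt (real (card J)) * C)"
    using C_bound(2) by (auto intro!: mult_right_mono)
  finally show ?thesis
    by (simp add: real_sqrt_mult algebra_simps)
qed

lemma Xnorm_windowed_sum_le:
  assumes k_less_kk: "k < kk" and finite_J: "finite J" and w_c00: "\<And>j. j \<in> J \<Longrightarrow> w j \<in> c00 kk"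
    and C_bound: "\<And>j. j \<in> J \<Longrightarrow> Xnorm kk (w j) \<le> C" "0 \<le> C"
    and separated: "separated_windows J lo hi" and not_low: "\<And>j t. j \<in> J \<Longrightarrow> w j t \<noteq> 0 \<Longrightarrow> \<not> t \<subseteq> {..<H}"
    and off_small: "\<And>j. j \<in> J \<Longrightarrow>
      Xnorm kk (cutoff (off_windows kk H (windows k (lo j) (hi j))) (w j)) \<le> \<delta>"
  shows "Xnorm kk (\<lambda>t. \<Sum>j\<in>J. w j t)
    \<le> real (card J) * \<delta> + (sqrt (real H) + real kk * real k) * C * sqrt (real (card J))"
proof -
  define A where "A j = off_windows kk H (windows k (lo j) (hi j))" for j
  have "Xnorm kk (\<lambda>t. \<Sum>j\<in>J. w j t)
      = Xnorm kk (\<lambda>t. (\<Sum>j\<in>J. cutoff (A j) (w j) t) + (\<Sum>j\<in>J. cutoff (- A j) (w j) t))"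
    by (simp add: sum.distrib[symmetric] cutoff_add_Compl)
  also have "\<dots> \<le> Xnorm kk (\<lambda>t. \<Sum>j\<in>J. cutoff (A j) (w j) t) + Xnorm kk (\<lambda>t. \<Sum>j\<in>J. cutoff (- A j) (w j) t)"
    by (intro Xnorm_add c00_sum c00_cutoff w_c00)
  also have "\<dots> \<le> (\<Sum>j\<in>J. \<delta>) + (sqrt (real H) + real kk * real k) * C * sqrt (real (card J))"
  proof (rule add_mono)
    show "Xnorm kk (\<lambda>t. \<Sum>j\<in>J. cutoff (A j) (w j) t) \<le> (\<Sum>j\<in>J. \<delta>)"
      using off_small by (intro order_trans[OF Xnorm_sum] sum_mono c00_cutoff w_c00) (auto simp: A_def)
    show "Xnorm kk (\<lambda>t. \<Sum>j\<in>J. cutoff (- A j) (w j) t)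
        \<le> (sqrt (real H) + real kk * real k) * C * sqrt (real (card J))"
    proof (rule Xnorm_sum_on_windows_le[OF k_less_kk finite_J c00_cutoff[OF w_c00] _
        C_bound(2) separated])
      show "Xnorm kk (cutoff (- A j) (w j)) \<le> C" if "j \<in> J" for j
        using order_trans[OF Xnorm_cutoff_le[OF w_c00] C_bound(1)] that by blast
      show "\<not> t \<subseteq> {..<H} \<and> t \<notin> off_windows kk H (windows k (lo j) (hi j))"
        if "j \<in> J" "cutoff (- A j) (w j) t \<noteq> 0" for j t
        using not_low[OF that(1), of t] that(2) unfolding cutoff_def A_def by (metis ComplD)
    qed
  qed
  finally show ?thesis
    by simp
qed

lemma alternating_sum_eq_sum_diff:
  fixes f :: "nat \<Rightarrow> real"
  shows "(\<Sum>j=1..2 * N. (-1) ^ j * f j) = (\<Sum>i=1..N. f (2 * i) - f (2 * i - 1))"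
  by (induction N) simp_all

lemma Xnorm_cutoff_alternating_sum_le:
  assumes w_c00: "\<And>j. j \<in> {1..2 * N} \<Longrightarrow> w j \<in> c00 kk"
    and close: "\<And>j j'. j \<in> {1..2 * N} \<Longrightarrow> j' \<in> {1..2 * N} \<Longrightarrow> Xnorm kk (cutoff B (\<lambda>t. w j t - w j' t)) \<le> \<epsilon>"
  shows "Xnorm kk (cutoff B (\<lambda>t. \<Sum>j=1..2 * N. (-1) ^ j * w j t)) \<le> real N * \<epsilon>"
proof -
  have "Xnorm kk (cutoff B (\<lambda>t. \<Sum>j=1..2 * N. (-1) ^ j * w j t))
      = Xnorm kk (\<lambda>t. \<Sum>i=1..N. cutoff B (\<lambda>t. w (2 * i) t - w (2 * i - 1) t) t)"
    unfolding alternating_sum_eq_sum_diff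
    by (intro arg_cong[where f = "Xnorm kk"]) (simp add: cutoff_def fun_eq_iff)
  also have "\<dots> \<le> (\<Sum>i=1..N. \<epsilon>)"
    by (intro order_trans[OF Xnorm_sum] sum_mono close c00_cutoff c00_diff w_c00) auto
  finally show ?thesis
    by simp
qed

lemma Xnorm_alternating_windowed_sum_le:
  assumes k_less_kk: "k < kk" and w_c00: "\<And>j. j \<in> {1..2 * N} \<Longrightarrow> w j \<in> c00 kk"
    and norm_le_C: "\<And>j. j \<in> {1..2 * N} \<Longrightarrow> Xnorm kk (w j) \<le> C" and "1 \<le> N"
    and separated: "separated_windows {1..2 * N} lo hi"
    and off_small: "\<And>j. j \<in> {1..2 * N} \<Longrightarrow>
      Xnorm kk (cutoff (off_windows kk H (windows k (lo j) (hi j))) (w j)) \<le> \<delta>"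
    and close: "\<And>j j'. j \<in> {1..2 * N} \<Longrightarrow> j' \<in> {1..2 * N} \<Longrightarrow>
      Xnorm kk (cutoff (Pow {..<H}) (\<lambda>t. w j t - w j' t)) \<le> \<epsilon>"
  shows "Xnorm kk (\<lambda>t. \<Sum>j=1..2 * N. (-1) ^ j * w j t)
    \<le> real N * \<epsilon> + real (2 * N) * \<delta> + (sqrt (real H) + real kk * real k) * C * sqrt (real (2 * N))"
proof -
  let ?B = "Pow {..<H}" and ?J = "{1..2 * N}"
  have "1 \<in> ?J"
    using \<open>1 \<le> N\<close> by simp
  then have "0 \<le> C"
    using order_trans[OF Xnorm_nonneg[OF w_c00] norm_le_C] by blast
  define v where "v j = (\<lambda>t. (-1) ^ j * cutoff (- ?B) (w j) t)" for j :: nat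
  have v_c00: "v j \<in> c00 kk" if "j \<in> ?J" for j
    unfolding v_def by (intro c00_cmult c00_cutoff w_c00 that)
  have v_norm: "Xnorm kk (cutoff A (v j)) \<le> Xnorm kk (cutoff A (w j))" if "j \<in> ?J" for A j
    by (intro Xnorm_mono c00_cutoff w_c00 that) (simp add: v_def cutoff_def abs_mult power_abs)
  have "Xnorm kk (\<lambda>t. \<Sum>j\<in>?J. (-1) ^ j * w j t)
      = Xnorm kk (\<lambda>t. cutoff ?B (\<lambda>t. \<Sum>j\<in>?J. (-1) ^ j * w j t) t + (\<Sum>j\<in>?J. v j t))"
    by (intro arg_cong[where f = "Xnorm kk"] ext) (simp add: v_def cutoff_def)
  also have "\<dots> \<le> Xnorm kk (cutoff ?B (\<lambda>t. \<Sum>j\<in>?J. (-1) ^ j * w j t)) + Xnorm kk (\<lambda>t. \<Sum>j\<in>?J. v j t)"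
    by (intro Xnorm_add c00_cutoff c00_sum c00_cmult w_c00 v_c00)
  also have "Xnorm kk (cutoff ?B (\<lambda>t. \<Sum>j\<in>?J. (-1) ^ j * w j t)) \<le> real N * \<epsilon>"
    by (intro Xnorm_cutoff_alternating_sum_le w_c00 close)
  also have "Xnorm kk (\<lambda>t. \<Sum>j\<in>?J. v j t)
      \<le> real (card ?J) * \<delta> + (sqrt (real H) + real kk * real k) * C * sqrt (real (card ?J))"
  proof (rule Xnorm_windowed_sum_le[OF k_less_kk _ v_c00 _ \<open>0 \<le> C\<close> separated])
    show "Xnorm kk (v j) \<le> C" if "j \<in> ?J" for j
      using order_trans[OF v_norm[of j UNIV] _] norm_le_C that by (simp add: cutoff_def)
    show "\<not> t \<subseteq> {..<H}" if "v j t \<noteq> 0" for j t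
      using that by (auto simp: v_def cutoff_def split: if_splits)
    show "Xnorm kk (cutoff (off_windows kk H (windows k (lo j) (hi j))) (v j)) \<le> \<delta>" if "j \<in> ?J" for j
      by (rule order_trans[OF v_norm off_small]) (use that in auto)
  qed auto
  finally show ?thesis
    by simp
qed

lemma ex_mult_sqrt_le_linear:
  fixes K c :: real
  assumes "0 < c"
  obtains N :: nat where "1 \<le> N" "K * sqrt (real (2 * N)) \<le> c * real (2 * N)"
proof -
  obtain N :: nat where N_large: "max 1 ((K / c)\<^sup>2) \<le> real N"
    using real_arch_simple by blast
  then have "(K / c)\<^sup>2 \<le> real (2 * N)"
    by simp
  then have "K / c \<le> sqrt (real (2 * N))"
    using real_le_rsqrt by blast
  then have "K * sqrt (real (2 * N)) \<le> c * sqrt (real (2 * N)) * sqrt (real (2 * N))"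
    using \<open>0 < c\<close> by (intro mult_right_mono) (auto simp: field_simps)
  also have "\<dots> = c * real (2 * N)"
    by simp
  finally show ?thesis
    using N_large by (intro that[of N]) auto
qed

lemma Ramsey_stabilization:
  assumes infinite_M: "infinite M" and w_c00: "\<And>s. s \<in> ksubsets M k \<Longrightarrow> w s \<in> c00 kk"
    and norm_le_C: "\<And>s. s \<in> ksubsets M k \<Longrightarrow> Xnorm kk (w s) \<le> C" and "1 \<le> kk" "0 < \<delta>" "0 < \<epsilon>"
  shows "\<exists>Y H Y'. Y \<subseteq> M \<and> infinite Y \<and> H \<in> Y \<and> Y' \<subseteq> Y - {..H} \<and> infinite Y' \<and>
    (\<forall>s\<in>ksubsets Y k. small_gaps kk \<delta> Y s (w s)) \<and>
    (\<forall>s\<in>ksubsets Y' k. \<forall>s'\<in>ksubsets Y' k. Xnorm kk (cutoff (Pow {..<H}) (\<lambda>t. w s t - w s' t)) \<le> \<epsilon>)"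
proof -
  obtain Y where Y: "Y \<subseteq> M" "infinite Y" and gaps: "\<forall>s\<in>ksubsets Y k. small_gaps kk \<delta> Y s (w s)"
    using Ramsey_small_gaps[of M k w kk C \<delta>, OF infinite_M w_c00 norm_le_C \<open>0 < \<delta>\<close>] by blast
  obtain H where H_in: "H \<in> Y"
    using Y(2) infinite_imp_nonempty by blast
  have "infinite (Y - {..H})"
    using Y(2) by simp
  moreover have "w s \<in> c00 kk" "Xnorm kk (w s) \<le> C" if "s \<in> ksubsets (Y - {..H}) k" for s
    using w_c00 norm_le_C ksubsets_mono[of "Y - {..H}" M k] Y(1) that by blast+
  ultimately obtain Y' where Y': "Y' \<subseteq> Y - {..H}" "infinite Y'"
    and close: "\<forall>s\<in>ksubsets Y' k. \<forall>s'\<in>ksubsets Y' k.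
      Xnorm kk (cutoff (Pow {..<H}) (\<lambda>t. w s t - w s' t)) \<le> \<epsilon>"
    using Ramsey_almost_equal_on_finite[of "Y - {..H}" k w kk C "Pow {..<H}" \<epsilon>] \<open>1 \<le> kk\<close> \<open>0 < \<epsilon>\<close> by auto
  show ?thesis
    using Y H_in Y' gaps close by (intro exI conjI)
qed

theorem alternating_plegma_sum_small:
  assumes k_bounds: "1 \<le> k" "k < kk" and infinite_M: "infinite M"
    and w_c00: "\<And>s. s \<in> ksubsets M k \<Longrightarrow> w s \<in> c00 kk"
    and norm_le_C: "\<And>s. s \<in> ksubsets M k \<Longrightarrow> Xnorm kk (w s) \<le> C" and "0 < c"
  shows "\<exists>m\<ge>1. \<forall>L. \<exists>s. plegma k M m s \<and> L \<le> el (s 1) 1 \<and>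
    Xnorm kk (\<lambda>t. \<Sum>j=1..m. (-1) ^ j * w (s j) t) \<le> c * real m"
proof -
  define \<delta> where "\<delta> = c / (4 * (real kk * real (Suc k)))"
  have "0 < \<delta>" and \<delta>_eq: "real kk * real (Suc k) * \<delta> = c / 4"
    using \<open>0 < c\<close> k_bounds by (simp_all add: \<delta>_def del: of_nat_Suc)
  have "1 \<le> kk" "0 < c / 2"
    using k_bounds \<open>0 < c\<close> by auto
  obtain Y H Y' where Y: "Y \<subseteq> M" "infinite Y" "H \<in> Y" and Y': "Y' \<subseteq> Y - {..H}" "infinite Y'"
    and gaps: "\<forall>s\<in>ksubsets Y k. small_gaps kk \<delta> Y s (w s)"
    and close: "\<forall>s\<in>ksubsets Y' k. \<forall>s'\<in>ksubsets Y' k.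
      Xnorm kk (cutoff (Pow {..<H}) (\<lambda>t. w s t - w s' t)) \<le> c / 2"
    using Ramsey_stabilization[of M k w kk C \<delta> "c / 2",
      OF infinite_M w_c00 norm_le_C \<open>1 \<le> kk\<close> \<open>0 < \<delta>\<close> \<open>0 < c / 2\<close>] by auto
  have w_c00_Y: "w s \<in> c00 kk" if "s \<in> ksubsets Y k" for s
    using w_c00 ksubsets_mono[OF Y(1)] that by blast
  have Y'_M: "ksubsets Y' k \<subseteq> ksubsets M k"
    using Y(1) Y'(1) by (intro ksubsets_mono) blast
  define K where "K = (sqrt (real H) + real kk * real k) * C"
  obtain N where N_large: "1 \<le> N" "K * sqrt (real (2 * N)) \<le> c / 2 * real (2 * N)"
    using ex_mult_sqrt_le_linear[OF \<open>0 < c / 2\<close>, of K] by blast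
  have "1 \<le> 2 * N"
    using N_large(1) by simp
  have "\<exists>s. plegma k M (2 * N) s \<and> L \<le> el (s 1) 1 \<and>
      Xnorm kk (\<lambda>t. \<Sum>j=1..2 * N. (-1) ^ j * w (s j) t) \<le> c * real (2 * N)" for L
  proof -
    obtain s lo hi where plegma: "plegma k Y' (2 * N) s" and L_le: "L \<le> el (s 1) 1"
      and separated: "separated_windows {1..2 * N} lo hi"
      and off_small: "\<forall>j\<in>{1..2 * N}.
        Xnorm kk (cutoff (off_windows kk H (windows k (lo j) (hi j))) (w (s j))) \<le> c / 4"
      using plegma_off_windows_small_exists[of Y H Y' k "2 * N" w kk \<delta> L,
          OF Y(2,3) Y'(2,1) k_bounds(1) \<open>1 \<le> 2 * N\<close> w_c00_Y] gaps
      unfolding \<delta>_eq by blast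
    have s_in: "s j \<in> ksubsets Y' k" if "j \<in> {1..2 * N}" for j
      using plegma that by (simp add: plegma_def)
    have "Xnorm kk (\<lambda>t. \<Sum>j=1..2 * N. (-1) ^ j * w (s j) t)
        \<le> real N * (c / 2) + real (2 * N) * (c / 4) + K * sqrt (real (2 * N))"
      unfolding K_def
    proof (rule Xnorm_alternating_windowed_sum_le[OF k_bounds(2) _ _ N_large(1) separated])
      show "w (s j) \<in> c00 kk" "Xnorm kk (w (s j)) \<le> C" if "j \<in> {1..2 * N}" for j
        using w_c00 norm_le_C s_in[OF that] Y'_M by blast+
    qed (use off_small close s_in in blast)+
    also have "\<dots> \<le> c * real (2 * N)"
      using N_large(2) by (simp add: field_simps)
    finally show ?thesis
      using plegma_mono[OF plegma] Y(1) Y'(1) L_le by blast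
  qed
  then show ?thesis
    using N_large(1) by (intro exI[of _ "2 * N"]) auto
qed

lemma abs_alternating_sum_disjoint:
  fixes x :: "nat \<Rightarrow> real"
  assumes "\<And>a b. a \<in> A \<Longrightarrow> b \<in> A \<Longrightarrow> a \<noteq> b \<Longrightarrow> x a = 0 \<or> x b = 0"
  shows "\<bar>\<Sum>a\<in>A. (-1) ^ a * x a\<bar> = \<bar>\<Sum>a\<in>A. x a\<bar>"
proof (cases "finite A \<and> (\<exists>a\<in>A. x a \<noteq> 0)")
  case True
  then obtain a where a_nonzero: "a \<in> A" "x a \<noteq> 0" "finite A" by blast
  then have "\<And>b. b \<in> A - {a} \<Longrightarrow> x b = 0"
    using assms[OF a_nonzero(1)] by auto
  then show ?thesis
    using sum.remove[OF a_nonzero(3,1), of x] sum.remove[OF a_nonzero(3,1), of "\<lambda>a. (-1) ^ a * x a"]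
    by (simp add: abs_mult power_abs)
qed auto

lemma disjoint_bounded_sum_small:
  assumes "2 \<le> kk" and x_c00_norm_le: "\<And>n. x n \<in> c00 kk" "\<And>n. Xnorm kk (x n) \<le> 1"
    and disjoint: "\<And>m n t. m \<noteq> n \<Longrightarrow> x m t = 0 \<or> x n t = 0" and "0 < c"
  shows "\<exists>A :: nat set. finite A \<and> A \<noteq> {} \<and> Xnorm kk (\<lambda>t. \<Sum>n\<in>A. x n t) \<le> c * real (card A)"
proof -
  have "\<exists>m\<ge>1. \<forall>L. \<exists>s. plegma 1 UNIV m s \<and> L \<le> el (s 1) 1 \<and>
      Xnorm kk (\<lambda>t. \<Sum>i=1..m. (-1) ^ i * x (el (s i) 1) t) \<le> c * real m"
    using assms by (intro alternating_plegma_sum_small[where w = "\<lambda>s. x (el s 1)" and C = 1]) auto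
  then obtain m s where m_pos: "1 \<le> m" and plegma: "plegma 1 UNIV m s"
    and small: "Xnorm kk (\<lambda>t. \<Sum>i=1..m. (-1) ^ i * x (el (s i) 1) t) \<le> c * real m"
    by blast
  define n where "n i = el (s i) 1" for i
  have inj_n: "inj_on n {1..m}"
    unfolding n_def by (rule inj_on_plegma_el[OF plegma order_refl order_refl])
  have "Xnorm kk (\<lambda>t. \<Sum>i=1..m. x (n i) t) = Xnorm kk (\<lambda>t. \<Sum>i=1..m. (-1) ^ i * x (n i) t)"
  proof (rule Xnorm_abs_cong)
    fix t
    have "x (n a) t = 0 \<or> x (n b) t = 0" if "a \<in> {1..m}" "b \<in> {1..m}" "a \<noteq> b" for a b
      using disjoint inj_onD[OF inj_n] that by blast
    then show "\<bar>\<Sum>i=1..m. x (n i) t\<bar> = \<bar>\<Sum>i=1..m. (-1) ^ i * x (n i) t\<bar>"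
      by (rule abs_alternating_sum_disjoint[symmetric])
  qed
  also have "\<dots> \<le> c * real m"
    using small by (simp add: n_def)
  finally have "Xnorm kk (\<lambda>t. \<Sum>i\<in>n ` {1..m}. x i t) \<le> c * real (card (n ` {1..m}))"
    unfolding sum.reindex[OF inj_n] card_image[OF inj_n] by simp
  then show ?thesis
    using m_pos by (intro exI[of _ "n ` {1..m}"]) auto
qed

subsection \<open>Spreading models and Cesaro means\<close>

lemma generates_smE:
  assumes "generates_sm k x M N"
  obtains \<delta> where "\<delta> \<longlonglongrightarrow> 0"
    "\<And>l m s a. 1 \<le> m \<Longrightarrow> m \<le> l \<Longrightarrow> plegma k M m s \<Longrightarrow> elM M l \<le> el (s 1) 1 \<Longrightarrow>
      \<forall>i\<in>{1..m}. \<bar>a i\<bar> \<le> 1 \<Longrightarrow> \<bar>norm (\<Sum>i=1..m. a i *\<^sub>R x (s i)) - N a m\<bar> \<le> \<delta> l"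
  using assms unfolding generates_sm_def by (elim conjE exE) (rule that, assumption, blast)

lemma generates_sm_bounded:
  assumes generates: "generates_sm k x M N" and "1 \<le> k"
  obtains C where "\<And>s. s \<in> ksubsets M k \<Longrightarrow> norm (x s) \<le> C"
proof -
  obtain \<delta> where estimate: "\<And>l m s a. 1 \<le> m \<Longrightarrow> m \<le> l \<Longrightarrow> plegma k M m s \<Longrightarrow> elM M l \<le> el (s 1) 1 \<Longrightarrow>
      \<forall>i\<in>{1..m}. \<bar>a i\<bar> \<le> 1 \<Longrightarrow> \<bar>norm (\<Sum>i=1..m. a i *\<^sub>R x (s i)) - N a m\<bar> \<le> \<delta> l"
    by (rule generates_smE[OF generates]) (rule that)
  have "norm (x s) \<le> N (\<lambda>_. 1) 1 + \<delta> 1" if s_in: "s \<in> ksubsets M k" for s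
  proof -
    have s_finite_card_subset: "finite s" "card s = k" "s \<subseteq> M"
      using s_in by (auto simp: ksubsets_def)
    have "plegma k M 1 (\<lambda>_. s)"
      using s_in el_less[OF s_finite_card_subset(1)] s_finite_card_subset(2) by (auto simp: plegma_def)
    moreover have "elM M 1 \<le> el s 1"
      using el_in[OF s_finite_card_subset(1), of 1] s_finite_card_subset \<open>1 \<le> k\<close>
      by (auto simp: elM_def enumerate_0 intro!: Least_le)
    ultimately show ?thesis
      using estimate[of 1 1 "\<lambda>_. s" "\<lambda>_. 1"] by simp
  qed
  then show ?thesis
    by (rule that)
qed

lemma l1_spreading_model_lower_estimate:
  assumes spreading_model: "k_spreading_model k x M nrm b" and l1: "equiv_l1_basis nrm b"
  obtains c where "0 < c"
    "\<And>m. 1 \<le> m \<Longrightarrow> \<exists>L. \<forall>s a. plegma k M m s \<longrightarrow> L \<le> el (s 1) 1 \<longrightarrow> (\<forall>i\<in>{1..m}. \<bar>a i\<bar> = 1) \<longrightarrow>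
      c * real m \<le> norm (\<Sum>i=1..m. a i *\<^sub>R x (s i))"
proof -
  obtain c where "0 < c" and lower: "\<And>m a. c * (\<Sum>i=1..m. \<bar>a i\<bar>) \<le> nrm (\<Sum>i=1..m. a i *\<^sub>R b i)"
    using l1 unfolding equiv_l1_basis_def by blast
  obtain \<delta> where \<delta>: "\<delta> \<longlonglongrightarrow> 0"
    and estimate: "\<And>l m s a. 1 \<le> m \<Longrightarrow> m \<le> l \<Longrightarrow> plegma k M m s \<Longrightarrow> elM M l \<le> el (s 1) 1 \<Longrightarrow>
      \<forall>i\<in>{1..m}. \<bar>a i\<bar> \<le> 1 \<Longrightarrow>
      \<bar>norm (\<Sum>i=1..m. a i *\<^sub>R x (s i)) - nrm (\<Sum>i=1..m. a i *\<^sub>R b i)\<bar> \<le> \<delta> l"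
    using spreading_model unfolding k_spreading_model_def
    by (elim conjE) (rule generates_smE, assumption, rule that)
  have "\<exists>L. \<forall>s a. plegma k M m s \<longrightarrow> L \<le> el (s 1) 1 \<longrightarrow> (\<forall>i\<in>{1..m}. \<bar>a i\<bar> = 1) \<longrightarrow>
      c / 2 * real m \<le> norm (\<Sum>i=1..m. a i *\<^sub>R x (s i))" if "1 \<le> m" for m
  proof -
    have "\<forall>\<^sub>F l in sequentially. \<delta> l < c / 2 \<and> m \<le> l"
      using order_tendstoD(2)[OF \<delta>, of "c / 2"] \<open>0 < c\<close>
      by (intro eventually_conj eventually_ge_at_top) simp
    then obtain l where l_large: "\<delta> l < c / 2" "m \<le> l"
      using eventually_happens'[OF sequentially_bot] by blast
    have "c / 2 * real m \<le> norm (\<Sum>i=1..m. a i *\<^sub>R x (s i))"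
      if "plegma k M m s" "elM M l \<le> el (s 1) 1" and abs_a: "\<forall>i\<in>{1..m}. \<bar>a i\<bar> = 1" for s a
    proof -
      have "\<bar>norm (\<Sum>i=1..m. a i *\<^sub>R x (s i)) - nrm (\<Sum>i=1..m. a i *\<^sub>R b i)\<bar> \<le> \<delta> l"
        using estimate that \<open>1 \<le> m\<close> l_large(2) by auto
      moreover have "c * real m \<le> nrm (\<Sum>i=1..m. a i *\<^sub>R b i)"
        using lower[of a m] abs_a by simp
      moreover have "c / 2 * 1 \<le> c / 2 * real m"
        using \<open>1 \<le> m\<close> \<open>0 < c\<close> by (intro mult_left_mono) auto
      ultimately show ?thesis
        using l_large(1) by linarith
    qed
    then show ?thesis
      by blast
  qed
  then show ?thesis
    using \<open>0 < c\<close> by (intro that[of "c / 2"]) auto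
qed

definition cesaro_mean :: "nat \<Rightarrow> (nat set \<Rightarrow> 'a::real_normed_vector) \<Rightarrow> nat set \<Rightarrow> nat \<Rightarrow> 'a" where
  "cesaro_mean k x M n = (1 / real (n choose k)) *\<^sub>R (\<Sum>s\<in>ksubsets (restr M n) k. x s)"

lemma inverse_choose_tendsto_0:
  assumes "1 \<le> k"
  shows "(\<lambda>n. 1 / real (n choose k)) \<longlonglongrightarrow> 0"
proof (rule Lim_null_comparison)
  show "(\<lambda>n. real k * (1 / real n)) \<longlonglongrightarrow> 0"
    using tendsto_mult_left[OF lim_1_over_n, of "real k"] by simp
  have "norm (1 / real (n choose k)) \<le> real k * (1 / real n)" if "k \<le> n" for n
  proof -
    have "1 \<le> real n / real k"
      using that assms by simp
    then have "real n / real k \<le> (real n / real k) ^ k"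
      using assms by (intro self_le_power) auto
    also have "\<dots> \<le> real (n choose k)"
      by (rule binomial_ge_n_over_k_pow_k[OF that])
    finally have "1 / real (n choose k) \<le> 1 / (real n / real k)"
      using that assms by (intro frac_le) auto
    then show ?thesis
      by simp
  qed
  then show "\<forall>\<^sub>F n in sequentially. norm (1 / real (n choose k)) \<le> real k * (1 / real n)"
    by (rule eventually_sequentiallyI)
qed

subsection \<open>Functionals and summability in Banach spaces\<close>

lemma closure_UNIV_induct:
  assumes "closure V = UNIV" "closed {y. P y}" "\<And>x. x \<in> V \<Longrightarrow> P x"
  shows "P y"
  using closure_minimal[of V "{y. P y}"] assms by auto

lemma bounded_on_subspace_imp_lipschitz_on:
  fixes g :: "'a::real_normed_vector \<Rightarrow> 'b::real_normed_vector"
  assumes subspace_V: "subspace V" and add: "\<And>x y. x \<in> V \<Longrightarrow> y \<in> V \<Longrightarrow> g (x + y) = g x + g y"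
    and bound: "\<And>x. x \<in> V \<Longrightarrow> norm (g x) \<le> norm x * K"
  shows "lipschitz_on (max K 0) V g"
proof (rule lipschitz_onI)
  fix x y assume x_y_in: "x \<in> V" "y \<in> V"
  then have "x - y \<in> V"
    by (rule subspace_diff[OF subspace_V])
  have "g x - g y = g (x - y)"
    using add[OF \<open>x - y \<in> V\<close> x_y_in(2)] by simp
  then have "norm (g x - g y) \<le> norm (x - y) * K"
    using bound[OF \<open>x - y \<in> V\<close>] by simp
  also have "\<dots> \<le> norm (x - y) * max K 0"
    by (intro mult_left_mono) auto
  finally show "dist (g x) (g y) \<le> max K 0 * dist x y"
    by (simp add: dist_norm mult.commute)
qed simp

lemma bounded_linear_extension_dense:
  fixes g :: "'a::real_normed_vector \<Rightarrow> 'b::banach"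
  assumes subspace_V: "subspace V" and dense: "closure V = UNIV"
    and add: "\<And>x y. x \<in> V \<Longrightarrow> y \<in> V \<Longrightarrow> g (x + y) = g x + g y"
    and scale: "\<And>r x. x \<in> V \<Longrightarrow> g (r *\<^sub>R x) = r *\<^sub>R g x"
    and bound: "\<And>x. x \<in> V \<Longrightarrow> norm (g x) \<le> norm x * K"
  obtains f :: "'a \<Rightarrow>\<^sub>L 'b" where "\<And>x. x \<in> V \<Longrightarrow> blinfun_apply f x = g x"
proof -
  have "uniformly_continuous_on V g"
    using bounded_on_subspace_imp_lipschitz_on[OF subspace_V add bound]
    by (rule lipschitz_on_uniformly_continuous)
  then obtain h where h_uniform: "uniformly_continuous_on (closure V) h"
    and h_eq: "\<And>x. x \<in> V \<Longrightarrow> g x = h x"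
    by (rule uniformly_continuous_on_extension_on_closure) (rule that)
  have continuous_h_comp: "continuous_on UNIV (\<lambda>y. h (F y))" if "continuous_on UNIV F" for F :: "'a \<Rightarrow> 'a"
    using continuous_on_compose2[OF uniformly_continuous_imp_continuous[OF h_uniform] that] dense by simp
  have "bounded_linear h"
  proof (rule bounded_linear_intro)
    have add_V: "h (x + z) = h x + h z" if "x \<in> V" for x z
    proof (rule closure_UNIV_induct[OF dense, of "\<lambda>z. h (x + z) = h x + h z"])
      show "h (x + z) = h x + h z" if "z \<in> V" for z
        using add[OF \<open>x \<in> V\<close> that] h_eq subspace_add[OF subspace_V] \<open>x \<in> V\<close> that by simp
    qed (intro closed_Collect_eq continuous_h_comp continuous_intros)
    show "h (y + z) = h y + h z" for y z
      by (rule closure_UNIV_induct[OF dense, of "\<lambda>y. h (y + z) = h y + h z"])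
        (intro closed_Collect_eq continuous_h_comp continuous_intros, rule add_V)
    show "h (r *\<^sub>R y) = r *\<^sub>R h y" for r y
    proof (rule closure_UNIV_induct[OF dense, of "\<lambda>y. h (r *\<^sub>R y) = r *\<^sub>R h y"])
      show "h (r *\<^sub>R x) = r *\<^sub>R h x" if "x \<in> V" for x
        using scale[OF that] h_eq subspace_scale[OF subspace_V] that by simp
    qed (intro closed_Collect_eq continuous_h_comp continuous_intros)
    show "norm (h y) \<le> norm y * K" for y
    proof (rule closure_UNIV_induct[OF dense, of "\<lambda>y. norm (h y) \<le> norm y * K"])
      show "norm (h x) \<le> norm x * K" if "x \<in> V" for x
        using bound[OF that] h_eq[OF that] by simp
    qed (intro closed_Collect_le continuous_h_comp continuous_intros)
  qed
  then show ?thesis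
    using h_eq by (intro that[of "Blinfun h"]) (simp add: bounded_linear_Blinfun_apply)
qed

lemma summable_on_if_disjoint_sums_small:
  fixes f :: "'i \<Rightarrow> 'a::banach"
  assumes "\<And>\<epsilon>. 0 < \<epsilon> \<Longrightarrow>
    \<exists>A. finite A \<and> A \<subseteq> I \<and> (\<forall>B. finite B \<longrightarrow> B \<subseteq> I \<longrightarrow> A \<inter> B = {} \<longrightarrow> norm (sum f B) < \<epsilon>)"
  shows "f summable_on I"
proof -
  have "\<exists>P. eventually P (finite_subsets_at_top I) \<and> (\<forall>F F'. P F \<and> P F' \<longrightarrow> dist (sum f F) (sum f F') < \<epsilon>)"
    if "0 < \<epsilon>" for \<epsilon>
  proof -
    obtain A where A: "finite A" "A \<subseteq> I"
      and small: "\<And>B. finite B \<Longrightarrow> B \<subseteq> I \<Longrightarrow> A \<inter> B = {} \<Longrightarrow> norm (sum f B) < \<epsilon> / 2"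
      using assms[of "\<epsilon> / 2"] \<open>0 < \<epsilon>\<close> by auto
    let ?P = "\<lambda>F. finite F \<and> A \<subseteq> F \<and> F \<subseteq> I"
    have near: "dist (sum f F) (sum f A) < \<epsilon> / 2" if "?P F" for F
      using small[of "F - A"] that by (auto simp: dist_norm sum_diff)
    have "dist (sum f F) (sum f F') < \<epsilon>" if "?P F" "?P F'" for F F'
      by (rule dist_triangle_half_l[OF near near]) (use that in auto)
    moreover have "eventually ?P (finite_subsets_at_top I)"
      using A unfolding eventually_finite_subsets_at_top by blast
    ultimately show ?thesis
      by (intro exI[of _ ?P]) simp
  qed
  then have "cauchy_filter (filtermap (sum f) (finite_subsets_at_top I))"
    by (simp add: cauchy_filter_metric_filtermap)
  moreover have "complete (UNIV :: 'a set)"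
    by (rule complete_UNIV)
  ultimately obtain y where "(sum f \<longlongrightarrow> y) (finite_subsets_at_top I)"
    using complete_uniform[where S = UNIV] by (force simp: filterlim_def)
  then show ?thesis
    unfolding summable_on_def has_sum_def by blast
qed

lemma reflexive_if_dense_span:
  fixes C :: "('a::real_normed_vector \<Rightarrow>\<^sub>L real) set"
  assumes dense: "closure (span C) = UNIV"
    and represented: "\<And>\<phi> :: ('a \<Rightarrow>\<^sub>L real) \<Rightarrow>\<^sub>L real. \<exists>y. \<forall>f\<in>C. blinfun_apply \<phi> f = blinfun_apply f y"
  shows "reflexive TYPE('a)"
  unfolding reflexive_def
proof
  fix \<phi> :: "('a \<Rightarrow>\<^sub>L real) \<Rightarrow>\<^sub>L real"
  obtain y where \<phi>_eq_on_C: "\<And>f. f \<in> C \<Longrightarrow> \<phi> f = f y"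
    using represented by blast
  have \<phi>_eq_on_span: "\<phi> f = f y" if "f \<in> span C" for f
    using that
  proof (induction rule: span_induct_alt)
    case (step c f g)
    then show ?case
      by (simp add: \<phi>_eq_on_C blinfun.add_right blinfun.add_left blinfun.scaleR_right blinfun.scaleR_left)
  qed simp
  have "\<phi> f = f y" for f
    by (rule closure_UNIV_induct[OF dense, of "\<lambda>f. \<phi> f = f y"])
      (intro closed_Collect_eq continuous_intros, rule \<phi>_eq_on_span)
  then show "\<exists>x. \<forall>f. \<phi> f = f x"
    by blast
qed

subsection \<open>The completion and its basis\<close>

locale completion =
  fixes kk :: nat and j :: "(nat set \<Rightarrow> real) \<Rightarrow> 'a::banach"
  assumes kk: "1 \<le> kk" and completion_map: "is_completion_map kk j"
begin

abbreviation I :: "nat set set" where "I \<equiv> ksubsets NN kk"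

abbreviation e :: "nat set \<Rightarrow> 'a" where "e s \<equiv> j (unitvec s)"

lemma j_add: "x \<in> c00 kk \<Longrightarrow> y \<in> c00 kk \<Longrightarrow> j (\<lambda>t. x t + y t) = j x + j y"
  and j_cmult: "x \<in> c00 kk \<Longrightarrow> j (\<lambda>t. c * x t) = c *\<^sub>R j x"
  and norm_j: "x \<in> c00 kk \<Longrightarrow> norm (j x) = Xnorm kk x"
  and dense: "closure (j ` c00 kk) = UNIV"
  using completion_map by (auto simp: is_completion_map_def)

lemma j_zero: "j (\<lambda>t. 0) = 0"
  using j_cmult[OF c00_zero, of 0] by simp

lemma j_diff:
  assumes "x \<in> c00 kk" "y \<in> c00 kk"
  shows "j (\<lambda>t. x t - y t) = j x - j y"
  using j_add[OF assms(1) c00_cmult[OF assms(2), of "-1"]] j_cmult[OF assms(2), of "-1"] by simp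

lemma j_sum:
  "(\<And>i. i \<in> A \<Longrightarrow> x i \<in> c00 kk) \<Longrightarrow> j (\<lambda>t. \<Sum>i\<in>A. x i t) = (\<Sum>i\<in>A. j (x i))"
proof (induction A rule: infinite_finite_induct)
  case (insert i A)
  then have "j (\<lambda>t. x i t + (\<Sum>i\<in>A. x i t)) = j (x i) + j (\<lambda>t. \<Sum>i\<in>A. x i t)"
    by (intro j_add c00_sum) auto
  then show ?case
    using insert by simp
qed (simp_all add: j_zero)

lemma subspace_range_j: "subspace (j ` c00 kk)"
  unfolding subspace_def
proof (intro conjI ballI allI)
  show "0 \<in> j ` c00 kk"
    using j_zero c00_zero by (metis imageI)
  show "y + z \<in> j ` c00 kk" if "y \<in> j ` c00 kk" "z \<in> j ` c00 kk" for y z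
    using that j_add c00_add by (smt (verit) image_iff)
  show "r *\<^sub>R y \<in> j ` c00 kk" if "y \<in> j ` c00 kk" for r y
    using that j_cmult c00_cmult by (smt (verit) image_iff)
qed

lemma dense_induct:
  "closed {y. P y} \<Longrightarrow> (\<And>x. x \<in> c00 kk \<Longrightarrow> P (j x)) \<Longrightarrow> P y"
  using closure_UNIV_induct[OF dense] by blast

lemma approximated_by_c00:
  assumes "0 < \<epsilon>"
  obtains x where "x \<in> c00 kk" "norm (y - j x) < \<epsilon>"
proof -
  have "y \<in> closure (j ` c00 kk)"
    by (simp add: dense)
  then obtain x where "x \<in> c00 kk" "dist (j x) y < \<epsilon>"
    unfolding closure_approachable using assms by blast
  then show ?thesis
    by (intro that) (auto simp: dist_norm norm_minus_commute)
qed

lemma sum_e_eq_j_cutoff: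
  assumes "finite A" "A \<subseteq> I"
  shows "(\<Sum>t\<in>A. x t *\<^sub>R e t) = j (cutoff A x)"
proof -
  have unitvec: "unitvec t \<in> c00 kk" if "t \<in> A" for t
    using that assms(2) by (intro c00_unitvec) auto
  have cutoff_eq: "cutoff A x = (\<lambda>u. \<Sum>t\<in>A. x t * unitvec t u)"
  proof
    fix u
    have "(\<Sum>t\<in>A. x t * unitvec t u) = (\<Sum>t\<in>A. if t = u then x t else 0)"
      by (intro sum.cong) (auto simp: unitvec_def)
    then show "cutoff A x u = (\<Sum>t\<in>A. x t * unitvec t u)"
      using assms(1) by (simp add: cutoff_def)
  qed
  show ?thesis
    unfolding cutoff_eq by (subst j_sum) (simp_all add: unitvec c00_cmult j_cmult)
qed

lemma norm_sum_e: "finite A \<Longrightarrow> A \<subseteq> I \<Longrightarrow> norm (\<Sum>t\<in>A. x t *\<^sub>R e t) = Xnorm kk (cutoff A x)"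
  by (simp add: sum_e_eq_j_cutoff norm_j c00_cutoff_finite)

lemma norm_sum_e_ge:
  assumes "finite A" "A \<subseteq> I" "schreier_plegmatic kk P" "P \<subseteq> A"
  shows "(\<Sum>t\<in>P. \<bar>x t\<bar>) \<le> norm (\<Sum>t\<in>A. x t *\<^sub>R e t)"
proof -
  have "(\<Sum>t\<in>P. \<bar>x t\<bar>) = (\<Sum>t\<in>P. \<bar>cutoff A x t\<bar>)"
    using assms(4) by (intro sum.cong) (auto simp: cutoff_def)
  also have "\<dots> \<le> norm (\<Sum>t\<in>A. x t *\<^sub>R e t)"
    unfolding norm_sum_e[OF assms(1,2)]
    by (intro sum_schreier_plegmatic_le_Xnorm c00_cutoff_finite assms)
  finally show ?thesis .
qed

lemma norm_sum_e_schreier_plegmatic: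
  assumes P_schreier: "schreier_plegmatic kk P"
  shows "norm (\<Sum>t\<in>P. x t *\<^sub>R e t) = (\<Sum>t\<in>P. \<bar>x t\<bar>)"
proof (rule antisym)
  have norm_e: "norm (e t) = 1" if "t \<in> P" for t
    using schreier_plegmatic_ksubsets[OF P_schreier] that Xnorm_unitvec[OF _ kk]
    by (simp add: norm_j c00_unitvec subset_iff)
  have "norm (\<Sum>t\<in>P. x t *\<^sub>R e t) \<le> (\<Sum>t\<in>P. norm (x t *\<^sub>R e t))"
    by (rule norm_sum)
  then show "norm (\<Sum>t\<in>P. x t *\<^sub>R e t) \<le> (\<Sum>t\<in>P. \<bar>x t\<bar>)"
    by (simp add: norm_e)
  show "(\<Sum>t\<in>P. \<bar>x t\<bar>) \<le> norm (\<Sum>t\<in>P. x t *\<^sub>R e t)"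
    using schreier_plegmatic_finite[OF P_schreier] schreier_plegmatic_ksubsets[OF P_schreier] P_schreier
    by (intro norm_sum_e_ge) auto
qed

lemma inj_j: "inj_on j (c00 kk)"
proof (intro inj_onI ext)
  fix x y t assume x_y: "x \<in> c00 kk" "y \<in> c00 kk" "j x = j y"
  have "\<bar>x t - y t\<bar> \<le> norm (j x - j y)"
    using abs_le_Xnorm[OF c00_diff[OF x_y(1,2)] kk] x_y by (simp add: norm_j[symmetric] c00_diff j_diff)
  then show "x t = y t"
    using x_y(3) by simp
qed

lemma coord_exists: "\<exists>f :: 'a \<Rightarrow>\<^sub>L real. \<forall>x\<in>c00 kk. f (j x) = x t"
proof -
  define g where "g y = inv_into (c00 kk) j y t" for y
  have g_j: "g (j x) = x t" if "x \<in> c00 kk" for x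
    using inv_into_f_f[OF inj_j that] by (simp add: g_def)
  show ?thesis
  proof (rule bounded_linear_extension_dense[OF subspace_range_j dense])
    show "g (y + z) = g y + g z" if "y \<in> j ` c00 kk" "z \<in> j ` c00 kk" for y z
      using that g_j[OF c00_add] by (auto simp: g_j j_add[symmetric])
    show "g (r *\<^sub>R y) = r *\<^sub>R g y" if "y \<in> j ` c00 kk" for r y
      using that g_j[OF c00_cmult] by (auto simp: g_j j_cmult[symmetric])
    show "norm (g y) \<le> norm y * 1" if "y \<in> j ` c00 kk" for y
      using that abs_le_Xnorm[OF _ kk] by (auto simp: g_j norm_j)
  qed (metis g_j imageI)
qed

definition coord :: "nat set \<Rightarrow> 'a \<Rightarrow>\<^sub>L real" where
  "coord t = (SOME f. \<forall>x\<in>c00 kk. blinfun_apply f (j x) = x t)"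

lemma coord_j: "x \<in> c00 kk \<Longrightarrow> coord t (j x) = x t"
  using someI_ex[OF coord_exists, of t] by (simp add: coord_def)

lemma coord_sum_e:
  "finite A \<Longrightarrow> A \<subseteq> I \<Longrightarrow> coord t (\<Sum>s\<in>A. x s *\<^sub>R e s) = cutoff A x t"
  by (simp add: sum_e_eq_j_cutoff coord_j c00_cutoff_finite)

definition proj :: "nat set set \<Rightarrow> 'a \<Rightarrow> 'a" where
  "proj A y = (\<Sum>t\<in>A. coord t y *\<^sub>R e t)"

lemma proj_diff: "proj A (y - z) = proj A y - proj A z"
  by (simp add: proj_def blinfun.diff_right scaleR_diff_left sum_subtractf)

lemma continuous_proj: "continuous_on UNIV (proj A)"
  unfolding proj_def by (intro continuous_intros)

lemma proj_j:
  assumes "finite A" "A \<subseteq> I" "x \<in> c00 kk"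
  shows "proj A (j x) = j (cutoff A x)"
  using assms by (simp add: proj_def coord_j sum_e_eq_j_cutoff)

lemma diff_proj_j:
  assumes "finite A" "A \<subseteq> I" "x \<in> c00 kk"
  shows "j x - proj A (j x) = j (cutoff (- A) x)"
proof -
  have "(\<lambda>t. x t - cutoff A x t) = cutoff (- A) x"
    by (auto simp: cutoff_def)
  then show ?thesis
    using assms j_diff[OF assms(3) c00_cutoff[OF assms(3)], of A] by (simp add: proj_j)
qed

lemma norm_diff_proj_le:
  assumes "finite A" "A \<subseteq> I"
  shows "norm (y - proj A y) \<le> norm y"
proof (rule dense_induct[of "\<lambda>y. norm (y - proj A y) \<le> norm y"])
  show "closed {y. norm (y - proj A y) \<le> norm y}"
    by (intro closed_Collect_le continuous_intros continuous_proj)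
  show "norm (j x - proj A (j x)) \<le> norm (j x)" if "x \<in> c00 kk" for x
    using that by (simp add: diff_proj_j assms norm_j c00_cutoff Xnorm_cutoff_le)
qed

lemma has_sum_coord: "((\<lambda>t. coord t y *\<^sub>R e t) has_sum y) I"
  unfolding has_sum_def
proof (rule tendstoI)
  fix \<epsilon> :: real assume "0 < \<epsilon>"
  then obtain x where x_close: "x \<in> c00 kk" "norm (y - j x) < \<epsilon>"
    using approximated_by_c00 by blast
  have "dist (proj B y) y < \<epsilon>" if B: "finite B" "{t. x t \<noteq> 0} \<subseteq> B" "B \<subseteq> I" for B
  proof -
    have "cutoff B x = x"
      using B by (auto simp: cutoff_def fun_eq_iff)
    then have "y - proj B y = (y - j x) - proj B (y - j x)"
      using B x_close by (simp add: proj_diff proj_j)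
    then have "norm (y - proj B y) \<le> norm (y - j x)"
      using norm_diff_proj_le[OF B(1,3), of "y - j x"] by metis
    then show ?thesis
      using x_close(2) by (simp add: dist_norm norm_minus_commute)
  qed
  moreover have "finite {t. x t \<noteq> 0} \<and> {t. x t \<noteq> 0} \<subseteq> I"
    using c00_finite[OF x_close(1)] c00_ksubsets[OF x_close(1)] by auto
  ultimately show "\<forall>\<^sub>F B in finite_subsets_at_top I. dist (\<Sum>t\<in>B. coord t y *\<^sub>R e t) y < \<epsilon>"
    unfolding eventually_finite_subsets_at_top proj_def by blast
qed

lemma has_sum_imp_coord:
  assumes "((\<lambda>t. a t *\<^sub>R e t) has_sum y) I" "t \<in> I"
  shows "a t = coord t y"
proof -
  have coord_e: "coord t (e s) = (if s = t then 1 else 0)" if "s \<in> I" for s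
    using coord_j[OF c00_unitvec[OF that], of t] by (simp add: unitvec_def)
  have "((\<lambda>s. coord t (a s *\<^sub>R e s)) has_sum coord t y) I"
    by (rule has_sum_bounded_linear[OF blinfun.bounded_linear_right assms(1)])
  moreover have "((\<lambda>s. coord t (a s *\<^sub>R e s)) has_sum a t) I"
    using assms(2) by (intro has_sum_finite_neutralI[of "{t}"]) (auto simp: blinfun.scaleR_right coord_e)
  ultimately show ?thesis
    using has_sum_unique by blast
qed

lemma unconditional_basis_e: "unconditional_basis I e"
  unfolding unconditional_basis_def
proof (intro conjI allI impI ballI)
  show "\<exists>a. ((\<lambda>t. a t *\<^sub>R e t) has_sum y) I" for y
    by (rule exI, rule has_sum_coord)
  fix y a a' t
  assume "((\<lambda>t. a t *\<^sub>R e t) has_sum y) I \<and> ((\<lambda>t. a' t *\<^sub>R e t) has_sum y) I" "t \<in> I"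
  then show "a t = a' t"
    using has_sum_imp_coord[of a y t] has_sum_imp_coord[of a' y t] by simp
qed

lemma eq_0_if_coords_eq_0: "(\<And>t. t \<in> I \<Longrightarrow> coord t y = 0) \<Longrightarrow> y = 0"
  using has_sum_coord[of y] has_sum_0[of I "\<lambda>t. coord t y *\<^sub>R e t"] has_sum_unique by fastforce

lemma generates_sm_e: "generates_sm kk e NN (\<lambda>a m. \<Sum>i=1..m. \<bar>a i\<bar>)"
  unfolding generates_sm_def
proof (intro conjI exI[of _ "\<lambda>l. 1 / real (Suc l)"] allI impI)
  show infinite_NN: "infinite NN"
    by (simp add: NN_def infinite_Ici)
  show "(\<lambda>l. 1 / real (Suc l)) \<longlonglongrightarrow> 0"
    by (rule LIMSEQ_Suc[OF lim_1_over_n])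
  fix l m :: nat and s :: "nat \<Rightarrow> nat set" and a :: "nat \<Rightarrow> real"
  assume m_le_l_plegma: "1 \<le> m \<and> m \<le> l \<and> plegma kk NN m s \<and>
    elM NN l \<le> el (s 1) 1 \<and> (\<forall>i\<in>{1..m}. \<bar>a i\<bar> \<le> 1)"
  then have "m \<le> el (s 1) 1"
    using le_elM[OF order_refl infinite_NN, of l] by linarith
  then have schreier: "schreier_plegmatic kk (s ` {1..m})"
    using m_le_l_plegma kk by (intro plegma_schreier_plegmatic) auto
  have inj_s: "inj_on s {1..m}"
    using inj_on_plegma_el[of kk NN m s 1] m_le_l_plegma kk
    by (intro inj_on_imageI2[of "\<lambda>t. el t 1"]) (simp add: comp_def)
  define b where "b t = a (inv_into {1..m} s t)" for t
  have b_s: "b (s i) = a i" if "i \<in> {1..m}" for i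
    unfolding b_def by (simp only: inv_into_f_f[OF inj_s that])
  have "(\<Sum>t\<in>s ` {1..m}. b t *\<^sub>R e t) = (\<Sum>i=1..m. a i *\<^sub>R e (s i))"
    by (subst sum.reindex[OF inj_s]) (simp add: b_s)
  moreover have "(\<Sum>t\<in>s ` {1..m}. \<bar>b t\<bar>) = (\<Sum>i=1..m. \<bar>a i\<bar>)"
    by (subst sum.reindex[OF inj_s]) (simp add: b_s)
  ultimately have "norm (\<Sum>i=1..m. a i *\<^sub>R e (s i)) = (\<Sum>i=1..m. \<bar>a i\<bar>)"
    using norm_sum_e_schreier_plegmatic[OF schreier, of b] by metis
  then show "\<bar>norm (\<Sum>i=1..m. a i *\<^sub>R e (s i)) - (\<Sum>i=1..m. \<bar>a i\<bar>)\<bar> \<le> 1 / real (Suc l)"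
    by simp
qed auto

subsection \<open>Reflexivity\<close>

lemma norm_schreier_functional_le:
  assumes P_admissible: "admissible kk J P" and b_bound: "\<And>i s. i \<in> J \<Longrightarrow> s \<in> P i \<Longrightarrow> \<bar>b i s\<bar> \<le> p i"
  shows "norm (\<Sum>i\<in>J. \<Sum>s\<in>P i. b i s *\<^sub>R coord s) \<le> L2_set p J"
proof (rule norm_blinfun_bound)
  let ?f = "\<Sum>i\<in>J. \<Sum>s\<in>P i. b i s *\<^sub>R coord s"
  show "norm (?f y) \<le> L2_set p J * norm y" for y
  proof (rule dense_induct[of "\<lambda>y. norm (?f y) \<le> L2_set p J * norm y"])
    show "closed {y. norm (?f y) \<le> L2_set p J * norm y}"
      by (intro closed_Collect_le continuous_intros)
    fix x assume x_c00: "x \<in> c00 kk"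
    have "?f (j x) = (\<Sum>i\<in>J. \<Sum>s\<in>P i. b i s * x s)"
      by (simp add: blinfun.sum_left blinfun.scaleR_left coord_j x_c00)
    also have "norm \<dots> \<le> (\<Sum>i\<in>J. \<Sum>s\<in>P i. p i * \<bar>x s\<bar>)"
      using b_bound by (intro order_trans[OF norm_sum] sum_mono order_trans[OF norm_sum])
        (simp add: abs_mult mult_right_mono)
    also have "\<dots> \<le> (\<Sum>i\<in>J. \<bar>p i\<bar> * \<bar>\<Sum>s\<in>P i. \<bar>x s\<bar>\<bar>)"
      unfolding sum_distrib_left[symmetric] by (intro sum_mono mult_mono) (auto simp: sum_nonneg)
    also have "\<dots> \<le> L2_set p J * family_norm J P x"
      unfolding family_norm_def by (rule L2_set_mult_ineq)
    also have "\<dots> \<le> L2_set p J * norm (j x)"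
      unfolding norm_j[OF x_c00] by (intro mult_left_mono family_norm_le_Xnorm x_c00 P_admissible) simp
    finally show "norm (?f (j x)) \<le> L2_set p J * norm (j x)" .
  qed
qed simp

text \<open>The norm of a finitely supported vector is approximated by explicit finite combinations of
  coordinate functionals, which replaces the Hahn-Banach theorem.\<close>

lemma Xnorm_bidual_le:
  fixes \<phi> :: "('a \<Rightarrow>\<^sub>L real) \<Rightarrow>\<^sub>L real"
  shows "Xnorm kk (cutoff A (\<lambda>t. \<phi> (coord t))) \<le> norm \<phi>"
proof (rule Xnorm_le)
  fix n :: nat and P assume P_admissible: "admissible kk {1..n} P"
  define y where "y = cutoff A (\<lambda>t. \<phi> (coord t))"
  define p where "p i = (\<Sum>s\<in>P i. \<bar>y s\<bar>)" for i
  define f where "f = (\<Sum>i=1..n. \<Sum>s\<in>P i. (p i * sgn (y s)) *\<^sub>R coord s)"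
  let ?v = "L2_set p {1..n}"
  have "norm f \<le> ?v"
    unfolding f_def by (intro norm_schreier_functional_le P_admissible)
      (simp add: p_def abs_mult abs_sgn_eq sum_nonneg)
  have "sgn (y s) * \<phi> (coord s) = \<bar>y s\<bar>" for s
    by (simp add: y_def cutoff_def abs_sgn mult.commute)
  then have "\<phi> f = (\<Sum>i=1..n. p i * p i)"
    by (simp add: f_def p_def blinfun.sum_right blinfun.scaleR_right mult.assoc
        sum_distrib_left[symmetric])
  also have "\<dots> = ?v * ?v"
    by (simp add: L2_set_def power2_eq_square[symmetric] sum_nonneg)
  finally have "?v * ?v \<le> norm \<phi> * norm f"
    using norm_blinfun[of \<phi> f] by simp
  also have "\<dots> \<le> norm \<phi> * ?v"
    using \<open>norm f \<le> ?v\<close> by (intro mult_left_mono) auto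
  finally have "0 < ?v \<Longrightarrow> ?v \<le> norm \<phi>"
    by (rule mult_right_le_imp_le)
  then have "?v \<le> norm \<phi>"
    using L2_set_nonneg[of p "{1..n}"] norm_ge_zero[of \<phi>] by (cases "0 < ?v") linarith+
  then show "family_norm {1..n} P (cutoff A (\<lambda>t. \<phi> (coord t))) \<le> norm \<phi>"
    unfolding family_norm_def y_def[symmetric] p_def[symmetric] .
qed

lemma bounded_partial_sums_imp_summable:
  assumes norm_le_K: "\<And>A. finite A \<Longrightarrow> A \<subseteq> I \<Longrightarrow> Xnorm kk (cutoff A c) \<le> K"
  shows "(\<lambda>t. c t *\<^sub>R e t) summable_on I"
proof (rule summable_on_if_disjoint_sums_small)
  fix \<epsilon> :: real assume "0 < \<epsilon>"
  define \<A> where "\<A> = {A. finite A \<and> A \<subseteq> I}"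
  define V where "V A = (Xnorm kk (cutoff A c))\<^sup>2" for A
  have bdd_above_V: "bdd_above (V ` \<A>)"
    using norm_le_K by (intro bdd_aboveI2[of _ _ "K\<^sup>2"])
      (auto simp: V_def \<A>_def intro!: power_mono Xnorm_nonneg c00_cutoff_finite)
  have "{} \<in> \<A>"
    by (simp add: \<A>_def)
  then obtain A where A: "A \<in> \<A>" "Sup (V ` \<A>) - \<epsilon>\<^sup>2 < V A"
    using less_cSup_iff[OF _ bdd_above_V, of "Sup (V ` \<A>) - \<epsilon>\<^sup>2"] \<open>0 < \<epsilon>\<close> by auto
  have "norm (\<Sum>t\<in>B. c t *\<^sub>R e t) < \<epsilon>" if B: "finite B" "B \<subseteq> I" "A \<inter> B = {}" for B
  proof -
    have A_Un_B_in: "A \<union> B \<in> \<A>"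
      using A(1) B by (auto simp: \<A>_def)
    have "A \<inter> (A \<union> B) = A" "- A \<inter> (A \<union> B) = B"
      using B(3) by auto
    then have "V A + V B \<le> V (A \<union> B)"
      using Xnorm_cutoff_Compl_power2[OF c00_cutoff_finite[of "A \<union> B" kk c], of A] A_Un_B_in
      by (simp add: V_def cutoff_cutoff \<A>_def)
    also have "\<dots> \<le> Sup (V ` \<A>)"
      using A_Un_B_in by (intro cSup_upper bdd_above_V) auto
    finally have "(Xnorm kk (cutoff B c))\<^sup>2 < \<epsilon>\<^sup>2"
      using A(2) by (simp add: V_def)
    then show ?thesis
      using \<open>0 < \<epsilon>\<close> by (simp add: norm_sum_e[OF B(1,2)] power2_less_imp_less)
  qed
  then show "\<exists>A. finite A \<and> A \<subseteq> I \<and>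
      (\<forall>B. finite B \<longrightarrow> B \<subseteq> I \<longrightarrow> A \<inter> B = {} \<longrightarrow> norm (\<Sum>t\<in>B. c t *\<^sub>R e t) < \<epsilon>)"
    using A(1) by (auto simp: \<A>_def)
qed

lemma bidual_represented_on_coords:
  fixes \<phi> :: "('a \<Rightarrow>\<^sub>L real) \<Rightarrow>\<^sub>L real"
  shows "\<exists>y. \<forall>f\<in>coord ` I. blinfun_apply \<phi> f = blinfun_apply f y"
proof -
  have "(\<lambda>t. \<phi> (coord t) *\<^sub>R e t) summable_on I"
    by (rule bounded_partial_sums_imp_summable[of _ "norm \<phi>"]) (rule Xnorm_bidual_le)
  then obtain y where "((\<lambda>t. \<phi> (coord t) *\<^sub>R e t) has_sum y) I"
    by (auto simp: summable_on_def)
  then have "\<phi> (coord t) = coord t y" if "t \<in> I" for t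
    using has_sum_imp_coord[of "\<lambda>t. \<phi> (coord t)" y] that by blast
  then show ?thesis
    by blast
qed

lemma norm_functional_le:
  fixes f :: "'a \<Rightarrow>\<^sub>L real"
  assumes "\<And>x. x \<in> c00 kk \<Longrightarrow> \<bar>f (j x)\<bar> \<le> K * Xnorm kk x" "0 \<le> K"
  shows "norm f \<le> K"
proof (rule norm_blinfun_bound[OF assms(2)])
  show "norm (f y) \<le> K * norm y" for y
  proof (rule dense_induct[of "\<lambda>y. norm (f y) \<le> K * norm y"])
    show "closed {y. norm (f y) \<le> K * norm y}"
      by (intro closed_Collect_le continuous_intros)
    show "norm (f (j x)) \<le> K * norm (j x)" if "x \<in> c00 kk" for x
      using assms(1)[OF that] by (simp add: norm_j that)
  qed
qed

lemma ex_normalized_multiple: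
  fixes f :: "'a \<Rightarrow>\<^sub>L real"
  assumes x_c00: "x \<in> c00 kk" and functional_large: "\<epsilon> * Xnorm kk x < \<bar>f (j x)\<bar>"
  shows "\<exists>z\<in>c00 kk. (\<forall>t. x t = 0 \<longrightarrow> z t = 0) \<and> Xnorm kk z \<le> 1 \<and> \<epsilon> \<le> f (j z)"
proof -
  have "j x \<noteq> 0"
    using functional_large by (auto simp: norm_j[OF x_c00, symmetric])
  then have norm_pos: "0 < Xnorm kk x"
    by (simp add: norm_j[OF x_c00, symmetric])
  define r where "r = sgn (f (j x)) / Xnorm kk x"
  have j_scaled: "j (\<lambda>t. r * x t) = r *\<^sub>R j x"
    by (rule j_cmult[OF x_c00])
  have "Xnorm kk (\<lambda>t. r * x t) = \<bar>r\<bar> * Xnorm kk x"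
    by (simp add: norm_j[OF x_c00, symmetric] norm_j[OF c00_cmult[OF x_c00], symmetric] j_scaled)
  also have "\<dots> \<le> 1"
    using norm_pos by (simp add: r_def abs_divide abs_sgn_eq)
  finally have "Xnorm kk (\<lambda>t. r * x t) \<le> 1" .
  moreover have "f (j (\<lambda>t. r * x t)) = \<bar>f (j x)\<bar> / Xnorm kk x"
    unfolding j_scaled by (simp add: r_def blinfun.scaleR_right abs_sgn mult.commute)
  then have "\<epsilon> \<le> f (j (\<lambda>t. r * x t))"
    using functional_large norm_pos by (simp add: pos_le_divide_eq less_imp_le)
  ultimately show ?thesis
    using c00_cmult[OF x_c00] by (intro bexI[of _ "\<lambda>t. r * x t"]) auto
qed

lemma functional_small_on_disjoint_sequence:
  fixes f :: "'a \<Rightarrow>\<^sub>L real"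
  assumes "2 \<le> kk" and x_c00_norm_le: "\<And>n. x n \<in> c00 kk" "\<And>n. Xnorm kk (x n) \<le> 1"
    and disjoint: "\<And>m n t. m \<noteq> n \<Longrightarrow> x m t = 0 \<or> x n t = 0" and "0 < \<epsilon>"
  shows "\<exists>n::nat. f (j (x n)) < \<epsilon>"
proof (rule ccontr)
  assume "\<not> ?thesis"
  then have large: "\<epsilon> \<le> f (j (x n))" for n
    by (simp add: not_less)
  define c where "c = \<epsilon> / (norm f + 1)"
  have "0 < norm f + 1"
    by (simp add: add_nonneg_pos)
  then have c_bounds: "0 < c" "norm f * c < \<epsilon>"
    using \<open>0 < \<epsilon>\<close> by (simp_all add: c_def pos_divide_less_eq distrib_left mult.commute)
  obtain A :: "nat set" where A: "finite A" "A \<noteq> {}" "Xnorm kk (\<lambda>t. \<Sum>n\<in>A. x n t) \<le> c * real (card A)"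
    using disjoint_bounded_sum_small[of kk x c, OF \<open>2 \<le> kk\<close> x_c00_norm_le disjoint c_bounds(1)] by blast
  have "\<epsilon> * real (card A) = (\<Sum>n\<in>A. \<epsilon>)"
    by simp
  also have "\<dots> \<le> (\<Sum>n\<in>A. f (j (x n)))"
    by (intro sum_mono large)
  also have "\<dots> = f (j (\<lambda>t. \<Sum>n\<in>A. x n t))"
    by (simp add: j_sum x_c00_norm_le blinfun.sum_right)
  also have "\<dots> \<le> norm f * norm (j (\<lambda>t. \<Sum>n\<in>A. x n t))"
    using norm_blinfun[of f "j (\<lambda>t. \<Sum>n\<in>A. x n t)"] by simp
  also have "\<dots> \<le> norm f * (c * real (card A))"
    using A(3) by (intro mult_left_mono) (simp_all add: norm_j c00_sum x_c00_norm_le)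
  also have "\<dots> < \<epsilon> * real (card A)"
    using c_bounds(2) A(1,2) by (simp add: mult.assoc[symmetric] card_gt_0_iff)
  finally show False
    by simp
qed

text \<open>A functional far from all finite combinations of coordinate functionals would be bounded away
  from zero on a disjointly supported bounded sequence. By unconditionality signs are irrelevant
  there, and plegma families of 1-subsets are just finite subsequences, so this contradicts the
  smallness of alternating sums.\<close>

lemma closure_span_coord:
  assumes "2 \<le> kk"
  shows "closure (span (coord ` I)) = UNIV"
proof (rule ccontr)
  assume "closure (span (coord ` I)) \<noteq> UNIV"
  then obtain f where "f \<notin> closure (span (coord ` I))"
    by blast
  then obtain \<epsilon> where "0 < \<epsilon>" and far: "\<And>g. g \<in> span (coord ` I) \<Longrightarrow> \<epsilon> \<le> dist g f"
    unfolding closure_approachable by (meson not_le)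
  have "\<exists>z\<in>c00 kk. (\<forall>t\<in>A. z t = 0) \<and> Xnorm kk z \<le> 1 \<and> \<epsilon> / 2 \<le> f (j z)"
    if A: "finite A" "A \<subseteq> I" for A
  proof -
    define g where "g = (\<Sum>t\<in>A. f (e t) *\<^sub>R coord t)"
    have "g \<in> span (coord ` I)"
      unfolding g_def using A(2) by (intro span_sum span_scale span_base) auto
    then have "\<not> norm (f - g) \<le> \<epsilon> / 2"
      using far[of g] \<open>0 < \<epsilon>\<close> by (simp add: dist_norm norm_minus_commute)
    then obtain x where x_large: "x \<in> c00 kk" "\<epsilon> / 2 * Xnorm kk x < \<bar>(f - g) (j x)\<bar>"
      using norm_functional_le[of "f - g" "\<epsilon> / 2"] \<open>0 < \<epsilon>\<close> by fastforce
    have "g (j x) = f (proj A (j x))"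
      by (simp add: g_def proj_def blinfun.sum_left blinfun.sum_right blinfun.scaleR_left
          blinfun.scaleR_right mult.commute)
    then have "(f - g) (j x) = f (j (cutoff (- A) x))"
      by (simp add: blinfun.diff_left blinfun.diff_right flip: diff_proj_j[OF A x_large(1)])
    moreover have "\<epsilon> / 2 * Xnorm kk (cutoff (- A) x) \<le> \<epsilon> / 2 * Xnorm kk x"
      using \<open>0 < \<epsilon>\<close> by (intro mult_left_mono Xnorm_cutoff_le x_large) auto
    ultimately have "\<epsilon> / 2 * Xnorm kk (cutoff (- A) x) < \<bar>f (j (cutoff (- A) x))\<bar>"
      using x_large(2) by linarith
    from ex_normalized_multiple[OF c00_cutoff[OF x_large(1)] this]
    obtain z where z_normalized: "z \<in> c00 kk" "Xnorm kk z \<le> 1" "\<epsilon> / 2 \<le> f (j z)"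
      and support: "\<forall>t. cutoff (- A) x t = 0 \<longrightarrow> z t = 0"
      by blast
    have "z t = 0" if "t \<in> A" for t
      using support that by (simp add: cutoff_def)
    then show ?thesis
      using z_normalized by blast
  qed
  then obtain z :: "nat \<Rightarrow> nat set \<Rightarrow> real"
    where z_normalized: "\<forall>n. z n \<in> c00 kk \<and> Xnorm kk (z n) \<le> 1 \<and> \<epsilon> / 2 \<le> f (j (z n))"
      "\<forall>m n t. m \<noteq> n \<longrightarrow> z m t = 0 \<or> z n t = 0"
    using disjoint_sequence_exists[of kk "\<lambda>z. Xnorm kk z \<le> 1 \<and> \<epsilon> / 2 \<le> f (j z)"] by blast
  then show False
    using functional_small_on_disjoint_sequence[OF assms, of z "\<epsilon> / 2" f] z_normalized \<open>0 < \<epsilon>\<close>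
    by (simp add: not_less[symmetric])
qed

lemma reflexive_completion: "2 \<le> kk \<Longrightarrow> reflexive TYPE('a)"
  by (rule reflexive_if_dense_span[OF closure_span_coord bidual_represented_on_coords])

subsection \<open>Spreading models of lower order\<close>

lemma alternating_plegma_norm_small:
  fixes x :: "nat set \<Rightarrow> 'a"
  assumes k_bounds: "1 \<le> k" "k < kk" and infinite_M: "infinite M"
    and norm_le_C: "\<And>s. s \<in> ksubsets M k \<Longrightarrow> norm (x s) \<le> C" and "0 < c"
  shows "\<exists>m\<ge>1. \<forall>L. \<exists>s. plegma k M m s \<and> L \<le> el (s 1) 1 \<and>
    norm (\<Sum>i=1..m. (-1) ^ i *\<^sub>R x (s i)) \<le> c * real m"
proof -
  have "\<exists>y. y \<in> c00 kk \<and> norm (x s - j y) < c / 2" for s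
    using approximated_by_c00[of "c / 2" "x s"] \<open>0 < c\<close> by auto
  then obtain w where w_close: "\<And>s. w s \<in> c00 kk" "\<And>s. norm (x s - j (w s)) < c / 2"
    by metis
  have "Xnorm kk (w s) \<le> C + c / 2" if "s \<in> ksubsets M k" for s
    using norm_le_C[OF that] w_close(2)[of s] norm_triangle_sub[of "j (w s)" "x s"]
    by (simp add: norm_j w_close(1) norm_minus_commute)
  then have "\<exists>m\<ge>1. \<forall>L. \<exists>s. plegma k M m s \<and> L \<le> el (s 1) 1 \<and>
      Xnorm kk (\<lambda>t. \<Sum>i=1..m. (-1) ^ i * w (s i) t) \<le> c / 2 * real m"
    using \<open>0 < c\<close> by (intro alternating_plegma_sum_small[OF k_bounds infinite_M w_close(1)]) auto
  moreover have "norm (\<Sum>i=1..m. (-1) ^ i *\<^sub>R x (s i)) \<le> c * real m"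
    if small: "Xnorm kk (\<lambda>t. \<Sum>i=1..m. (-1) ^ i * w (s i) t) \<le> c / 2 * real m" for m :: nat and s
  proof -
    have "norm (\<Sum>i=1..m. (-1) ^ i *\<^sub>R (x (s i) - j (w (s i)))) \<le> (\<Sum>i=1..m. c / 2)"
      using w_close(2) by (intro order_trans[OF norm_sum] sum_mono) (simp add: power_abs less_imp_le)
    moreover have "(\<Sum>i=1..m. (-1) ^ i *\<^sub>R j (w (s i))) = j (\<lambda>t. \<Sum>i=1..m. (-1) ^ i * w (s i) t)"
      by (simp add: j_sum c00_cmult w_close(1) j_cmult)
    then have "norm (\<Sum>i=1..m. (-1) ^ i *\<^sub>R j (w (s i))) \<le> c / 2 * real m"
      using small by (simp add: norm_j c00_sum c00_cmult w_close(1))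
    ultimately show ?thesis
      using norm_triangle_ineq[of "\<Sum>i=1..m. (-1) ^ i *\<^sub>R (x (s i) - j (w (s i)))"
          "\<Sum>i=1..m. (-1) ^ i *\<^sub>R j (w (s i))"]
      by (simp add: scaleR_diff_right sum_subtractf mult.commute)
  qed
  ultimately show ?thesis
    by blast
qed

lemma no_l1_spreading_model:
  fixes x :: "nat set \<Rightarrow> 'a" and nrm :: "'e::real_vector \<Rightarrow> real"
  assumes k_bounds: "1 \<le> k" "k < kk" and spreading_model: "k_spreading_model k x M nrm b"
  shows "\<not> equiv_l1_basis nrm b"
proof
  assume "equiv_l1_basis nrm b"
  then obtain c where "0 < c" and lower: "\<And>m. 1 \<le> m \<Longrightarrow> \<exists>L. \<forall>s a. plegma k M m s \<longrightarrow> L \<le> el (s 1) 1 \<longrightarrow>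
      (\<forall>i\<in>{1..m}. \<bar>a i\<bar> = 1) \<longrightarrow> c * real m \<le> norm (\<Sum>i=1..m. a i *\<^sub>R x (s i))"
    using l1_spreading_model_lower_estimate[OF spreading_model] by blast
  have generates: "generates_sm k x M (\<lambda>a m. nrm (\<Sum>i=1..m. a i *\<^sub>R b i))"
    using spreading_model by (simp add: k_spreading_model_def)
  then have "infinite M"
    by (simp add: generates_sm_def)
  moreover obtain C where "\<And>s. s \<in> ksubsets M k \<Longrightarrow> norm (x s) \<le> C"
    using generates_sm_bounded[OF generates k_bounds(1)] by blast
  ultimately obtain m where m_pos: "1 \<le> m" and small: "\<And>L. \<exists>s. plegma k M m s \<and> L \<le> el (s 1) 1 \<and>
      norm (\<Sum>i=1..m. (-1) ^ i *\<^sub>R x (s i)) \<le> c / 2 * real m"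
    using alternating_plegma_norm_small[OF k_bounds, of M x C "c / 2"] \<open>0 < c\<close> by auto
  obtain L where L: "\<And>s a. plegma k M m s \<Longrightarrow> L \<le> el (s 1) 1 \<Longrightarrow> (\<forall>i\<in>{1..m}. \<bar>a i\<bar> = 1) \<Longrightarrow>
      c * real m \<le> norm (\<Sum>i=1..m. a i *\<^sub>R x (s i))"
    using lower[OF m_pos] by blast
  obtain s where s_small: "plegma k M m s" "L \<le> el (s 1) 1"
    "norm (\<Sum>i=1..m. (-1) ^ i *\<^sub>R x (s i)) \<le> c / 2 * real m"
    using small by blast
  have "c * real m \<le> c / 2 * real m"
    using L[OF s_small(1,2), of "\<lambda>i. (-1) ^ i"] s_small(3) by (simp add: power_abs)
  then show False
    using \<open>0 < c\<close> m_pos by simp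
qed

subsection \<open>Cesaro means of the basis\<close>

lemma cesaro_mean_e_limit_eq_0:
  assumes M: "M \<subseteq> NN" "infinite M" and mean_tendsto: "cesaro_mean kk e M \<longlonglongrightarrow> x0"
  shows "x0 = 0"
proof (rule eq_0_if_coords_eq_0)
  fix t
  have Q: "finite (ksubsets (restr M n) kk)" "ksubsets (restr M n) kk \<subseteq> I" for n
    using finite_ksubsets[OF finite_restr] ksubsets_mono restr_subset[OF M(2)] M(1) by blast+
  have "norm (coord t (cesaro_mean kk e M n)) \<le> 1 / real (n choose kk)" for n
    using coord_sum_e[OF Q[of n], of t "\<lambda>_. 1"]
    by (simp add: cesaro_mean_def blinfun.scaleR_right cutoff_def)
  then have "(\<lambda>n. coord t (cesaro_mean kk e M n)) \<longlonglongrightarrow> 0"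
    by (intro Lim_null_comparison[OF _ inverse_choose_tendsto_0[OF kk]] always_eventually) blast
  moreover have "(\<lambda>n. coord t (cesaro_mean kk e M n)) \<longlonglongrightarrow> coord t x0"
    by (intro tendsto_intros mean_tendsto)
  ultimately show "coord t x0 = 0"
    using LIMSEQ_unique by blast
qed

lemma norm_cesaro_mean_e_ge:
  assumes M: "M \<subseteq> NN" "infinite M" and N_pos: "1 \<le> N"
  shows "1 / real (kk + 1) ^ kk \<le> norm (cesaro_mean kk e M ((kk + 1) * N))"
proof -
  let ?n = "(kk + 1) * N"
  let ?Q = "ksubsets (restr M ?n) kk"
  obtain P where P: "schreier_plegmatic kk P" "P \<subseteq> ?Q" "N ^ kk \<le> card P"
    by (rule large_schreier_plegmatic_subfamily[OF M kk N_pos]) (rule that)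
  have Q: "finite ?Q" "?Q \<subseteq> I"
    using finite_ksubsets[OF finite_restr] ksubsets_mono restr_subset[OF M(2)] M(1) by blast+
  have "kk \<le> ?n"
    using mult_le_mono[OF le_add1[of kk 1] N_pos] by simp
  then have choose_bounds: "0 < real (?n choose kk)" "real (?n choose kk) \<le> real ?n ^ kk"
    using binomial_le_pow[of kk ?n] by (simp, metis of_nat_le_iff of_nat_power)
  have "1 / real (kk + 1) ^ kk = real N ^ kk / real ?n ^ kk"
    unfolding of_nat_mult power_mult_distrib using N_pos by simp
  also have "\<dots> \<le> real (card P) / real (?n choose kk)"
    using P(3) choose_bounds by (intro frac_le) (simp_all flip: of_nat_power)
  also have "\<dots> = (1 / real (?n choose kk)) * (\<Sum>t\<in>P. \<bar>1\<bar>)"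
    by simp
  also have "\<dots> \<le> (1 / real (?n choose kk)) * norm (\<Sum>t\<in>?Q. 1 *\<^sub>R e t)"
    using choose_bounds(1) by (intro mult_left_mono norm_sum_e_ge Q P) auto
  also have "\<dots> = norm (cesaro_mean kk e M ?n)"
    by (simp add: cesaro_mean_def)
  finally show ?thesis .
qed

lemma not_cesaro_summable:
  assumes M: "M \<subseteq> NN" "infinite M"
  shows "\<not> cesaro_summable kk e M x0"
proof
  assume "cesaro_summable kk e M x0"
  then have mean_tendsto: "cesaro_mean kk e M \<longlonglongrightarrow> x0"
    by (simp add: cesaro_summable_def cesaro_mean_def[abs_def])
  have "strict_mono (\<lambda>N. (kk + 1) * N)"
    by (rule strict_monoI, rule mult_less_mono2) auto
  then have "(\<lambda>N. norm (cesaro_mean kk e M ((kk + 1) * N))) \<longlonglongrightarrow> norm x0"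
    using LIMSEQ_subseq_LIMSEQ[OF mean_tendsto] by (intro tendsto_norm) (simp add: comp_def)
  moreover have "\<forall>\<^sub>F N in sequentially. 1 / real (kk + 1) ^ kk \<le>
      norm (cesaro_mean kk e M ((kk + 1) * N))"
    using norm_cesaro_mean_e_ge[OF M] by (rule eventually_sequentiallyI)
  ultimately have "1 / real (kk + 1) ^ kk \<le> norm x0"
    by (rule tendsto_lowerbound) simp
  moreover have "0 < 1 / real (kk + 1) ^ kk"
    by (intro divide_pos_pos zero_less_power) auto
  moreover have "norm x0 = 0"
    using cesaro_mean_e_limit_eq_0[OF M mean_tendsto] by simp
  ultimately show False
    by linarith
qed

end

theorem mainTheorem19:
  fixes k :: nat and j :: "(nat set \<Rightarrow> real) \<Rightarrow> 'a::banach"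
  assumes "k \<ge> 1"
    and "is_completion_map (k + 1) j"
  shows
   "(unconditional_basis (ksubsets NN (k + 1)) (\<lambda>s. j (unitvec s)) \<and>
     (\<exists>M. generates_sm (k + 1) (\<lambda>s. j (unitvec s)) M (\<lambda>a m. \<Sum>i=1..m. \<bar>a i\<bar>))) \<and>
    reflexive TYPE('a) \<and>
    (\<forall>(x :: nat set \<Rightarrow> 'a) M (nrm :: 'e::real_vector \<Rightarrow> real) e.
        k_spreading_model k x M nrm e \<longrightarrow> \<not> equiv_l1_basis nrm e) \<and>
    (\<forall>M x0. M \<subseteq> NN \<and> infinite M \<longrightarrow> \<not> cesaro_summable (k + 1) (\<lambda>s. j (unitvec s)) M x0)"
proof -
  interpret completion "k + 1" j
    by unfold_locales (use assms in auto)
  show ?thesis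
  proof (intro conjI allI impI)
    show "unconditional_basis (ksubsets NN (k + 1)) (\<lambda>s. j (unitvec s))"
      by (rule unconditional_basis_e)
    show "\<exists>M. generates_sm (k + 1) (\<lambda>s. j (unitvec s)) M (\<lambda>a m. \<Sum>i=1..m. \<bar>a i\<bar>)"
      by (rule exI, rule generates_sm_e)
    show "reflexive TYPE('a)"
      using assms(1) by (intro reflexive_completion) simp
    show "\<not> equiv_l1_basis nrm b" if "k_spreading_model k x M nrm b"
      for x :: "nat set \<Rightarrow> 'a" and M and nrm :: "'e \<Rightarrow> real" and b
      using assms(1) that by (intro no_l1_spreading_model) auto
    show "\<not> cesaro_summable (k + 1) (\<lambda>s. j (unitvec s)) M x0" if "M \<subseteq> NN \<and> infinite M" for M x0
      using that by (intro not_cesaro_summable) auto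
  qed
qed

end
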